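(* For $\tau\in\mathbb{H}$, the function $$\Psi (\tau) := \sum_{\bm n \in\mathbb{Z}^2+\left( \frac13,\frac13 \right) } \mathrm{sgn} (n_1)\, \mathrm{sgn} (n_2)\,n_1\, q^{n_1^2+n_1n_2+n_2^2}\qquad (q=e^{2\pi i\tau})$$ satisfies $$\Psi (\tau) = \frac{\sqrt{3}}{2 \pi} \int_\tau^{\tau +i\infty} \left(\ {}_{*}\!\!\int_{\tau}^{w_1} \frac{h(\bm w)}{(i(w_2-\tau))^{\frac 32}}\, dw_2\right) \frac{dw_1}{\sqrt{i(w_1-\tau)}} ,$$ where $$h (\bm w ) := \vartheta_{3,1}^{[1]} (w_1)\, \vartheta_{1,1} (w_2) - \vartheta_{3,2}^{[1]} (w_1)\, \vartheta_{1,0} (w_2) .$$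
   Context: $\mathbb{H}$ is the upper half-plane; $\mathrm{sgn}(x)=x/|x|$ for $x\ne0$, $\mathrm{sgn}(0)=0$; $\bm w=(w_1,w_2)$. For $m\in\mathbb{Z}_{>0}$, $r\in\mathbb{Z}$, $k\in\mathbb{N}_0$: $\vartheta_{m,r}^{[k]}(\tau)=\sum_{n\in\mathbb{Z}+\frac{r}{2m}}n^k q^{mn^2}$ and $\vartheta_{m,r}=\vartheta_{m,r}^{[0]}$. Square roots are principal and $(x)^{3/2}=(\sqrt{x})^3$. The outer integral is along the vertical path from $\tau$ to $i\infty$. For $w_1\in\mathbb{H}\setminus\{\tau\}$ the regularized integral is $${}_{*}\!\!\int_{\tau}^{w_1} \frac{f(w_2)}{(i (w_2-\tau))^{\frac{3}{2}}}\, dw_2 := \lim_{\mathfrak z \to \tau} \left(\int_{\mathfrak z}^{w_1} \frac{f(w_2)}{(i (w_2-\tau))^{\frac{3}{2}}}\, dw_2+ 2 i\, \frac{f(\tau)}{\sqrt{i(\mathfrak z-\tau)}}\right),$$ where the integral and the one-sided limit are taken along the hyperbolic geodesic from $\tau$ to $w_1$. *)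

theory Defs
  imports "HOL-Complex_Analysis.Complex_Analysis"
begin

definition qpow :: "complex \<Rightarrow> real \<Rightarrow> complex" where
  "qpow \<tau> x = exp (2 * of_real pi * \<i> * \<tau> * of_real x)"

definition int_coset :: "real \<Rightarrow> real set" where
  "int_coset a = {of_int j + a | j :: int. True}"

definition theta :: "nat \<Rightarrow> int \<Rightarrow> nat \<Rightarrow> complex \<Rightarrow> complex" where
  "theta m r k \<tau> =
     (\<Sum>\<^sub>\<infinity>n \<in> int_coset (of_int r / (2 * of_nat m)). of_real (n ^ k) * qpow \<tau> (of_nat m * n ^ 2))"

definition Psi_term :: "complex \<Rightarrow> real \<times> real \<Rightarrow> complex" where
  "Psi_term \<tau> = (\<lambda>(n1, n2).
     of_real (sgn n1 * sgn n2 * n1) * qpow \<tau> (n1 ^ 2 + n1 * n2 + n2 ^ 2))"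

definition Psi :: "complex \<Rightarrow> complex" where
  "Psi \<tau> = (\<Sum>\<^sub>\<infinity>n \<in> int_coset (1/3) \<times> int_coset (1/3). Psi_term \<tau> n)"

definition h :: "complex \<Rightarrow> complex \<Rightarrow> complex" where
  "h w1 w2 = theta 3 1 1 w1 * theta 1 1 0 w2 - theta 3 2 1 w1 * theta 1 0 0 w2"

text \<open>
  The hyperbolic geodesic segment from \<open>\<tau>\<close> to \<open>w\<close> in the upper half-plane: a vertical segment, or
  an arc of the circle through \<open>\<tau>\<close> and \<open>w\<close> whose centre \<open>c\<close> lies on the real axis. The arguments
  of \<open>\<tau> - c\<close> and \<open>w - c\<close> lie in \<open>(0, \<pi>)\<close>, so the arc stays in the upper half-plane.
\<close>
definition hyp_geodesic :: "complex \<Rightarrow> complex \<Rightarrow> real \<Rightarrow> complex" where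
  "hyp_geodesic \<tau> w =
     (if Re \<tau> = Re w then linepath \<tau> w
      else let c = complex_of_real (((cmod w)\<^sup>2 - (cmod \<tau>)\<^sup>2) / (2 * (Re w - Re \<tau>)))
           in part_circlepath c (cmod (\<tau> - c)) (Arg (\<tau> - c)) (Arg (w - c)))"

lemma hyp_geodesic_endpoints:
  "pathstart (hyp_geodesic \<tau> w) = \<tau>" "pathfinish (hyp_geodesic \<tau> w) = w"
proof -
  have "pathstart (hyp_geodesic \<tau> w) = \<tau> \<and> pathfinish (hyp_geodesic \<tau> w) = w"
  proof (cases "Re \<tau> = Re w")
    case False
    define c where "c = complex_of_real (((cmod w)\<^sup>2 - (cmod \<tau>)\<^sup>2) / (2 * (Re w - Re \<tau>)))"
    have "2 * Re c * (Re w - Re \<tau>) = (cmod w)\<^sup>2 - (cmod \<tau>)\<^sup>2"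
      using False by (simp add: c_def divide_simps) (simp add: algebra_simps)
    moreover have "Im c = 0" by (simp add: c_def)
    ultimately have "(cmod (\<tau> - c))\<^sup>2 = (cmod (w - c))\<^sup>2"
      by (simp add: cmod_power2 power2_diff algebra_simps)
    then have r: "cmod (\<tau> - c) = cmod (w - c)" by simp
    have polar: "c + cmod z * exp (\<i> * Arg z) = c + z" for z
      using Arg_eq[of z] by (cases "z = 0") (auto simp: is_Arg_def)
    have "hyp_geodesic \<tau> w = part_circlepath c (cmod (\<tau> - c)) (Arg (\<tau> - c)) (Arg (w - c))"
      using False by (simp only: hyp_geodesic_def c_def Let_def if_False)
    then show ?thesis
      using polar[of "\<tau> - c"] polar[of "w - c"] r by simp
  qed (simp add: hyp_geodesic_def)
  then show "pathstart (hyp_geodesic \<tau> w) = \<tau>" "pathfinish (hyp_geodesic \<tau> w) = w" by auto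
qed

text \<open>
  The expression whose limit defines the regularized integral, with \<open>z = \<gamma> t\<close> on the geodesic
  \<open>\<gamma>\<close> from \<open>\<tau>\<close> to \<open>w1\<close>. On the vertical ray above \<open>\<tau>\<close> the argument of the square root is a negative
  real, where \<open>csqrt (- s) = \<i> * sqrt s\<close>.
\<close>
definition reg_approx :: "complex \<Rightarrow> complex \<Rightarrow> (complex \<Rightarrow> complex) \<Rightarrow> real \<Rightarrow> complex" where
  "reg_approx \<tau> w1 f t =
     (let \<gamma> = hyp_geodesic \<tau> w1 in
        contour_integral (subpath t 1 \<gamma>) (\<lambda>w2. f w2 / csqrt (\<i> * (w2 - \<tau>)) ^ 3)
        + 2 * \<i> * (f \<tau> / csqrt (\<i> * (\<gamma> t - \<tau>))))"

definition reg_integrable :: "complex \<Rightarrow> complex \<Rightarrow> (complex \<Rightarrow> complex) \<Rightarrow> bool" where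
  "reg_integrable \<tau> w1 f \<longleftrightarrow> (\<exists>L. (reg_approx \<tau> w1 f \<longlongrightarrow> L) (at_right 0))"

definition reg_integral :: "complex \<Rightarrow> complex \<Rightarrow> (complex \<Rightarrow> complex) \<Rightarrow> complex" where
  "reg_integral \<tau> w1 f = Lim (at_right 0) (reg_approx \<tau> w1 f)"

text \<open>
  Integration along the vertical path \<open>w = \<tau> + \<i> * s\<close>, \<open>s > 0\<close>, so that \<open>dw = \<i> ds\<close>.
\<close>
definition vertical_integrable :: "complex \<Rightarrow> (complex \<Rightarrow> complex) \<Rightarrow> bool" where
  "vertical_integrable \<tau> g \<longleftrightarrow> (\<lambda>s. g (\<tau> + \<i> * of_real s) * \<i>) integrable_on {0<..}"

definition vertical_integral :: "complex \<Rightarrow> (complex \<Rightarrow> complex) \<Rightarrow> complex" where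
  "vertical_integral \<tau> g = integral {0<..} (\<lambda>s. g (\<tau> + \<i> * of_real s) * \<i>)"

end

theory Submission
  imports Defs
begin

text \<open>
  On the vertical ray above \<open>\<tau>\<close> everything is a real-variable integral. With
  \<open>n\<^sub>3 = - n\<^sub>1 - n\<^sub>2\<close>, the function \<open>h\<close> is a sum over the lattice coset of \<open>\<Psi>\<close>:
  \<open>n\<^sub>1 / 2\<close> times \<open>q\<^sub>1\<close> to the power \<open>3 n\<^sub>1\<^sup>2 / 4\<close> times \<open>q\<^sub>2\<close> to the power \<open>(n\<^sub>2 + n\<^sub>1 / 2)\<^sup>2\<close>.
  The permutations of \<open>n\<^sub>1, n\<^sub>2, n\<^sub>3\<close> preserve the coset and the form, so \<open>h w w = 0\<close>. Hence
  integration by parts removes the boundary terms of the regularized integral, and the remaining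
  double integral can be evaluated termwise by Tonelli. This gives
  \<open>(2 / \<pi>) \<Sum> y arctan (y / x)\<close> times \<open>q\<close> to the power \<open>x\<^sup>2 + y\<^sup>2\<close>, where
  \<open>x = \<surd>3 n\<^sub>1 / 2\<close> and \<open>y = (n\<^sub>2 - n\<^sub>3) / 2\<close>. A cyclic shift rotates \<open>(x, y)\<close> by
  \<open>2 \<pi> / 3\<close>, so it changes the arctangent by a constant that depends only on the signs of the
  \<open>n\<^sub>i\<close>; averaging over the permutations therefore turns the sum into \<open>\<Psi>\<close>.
\<close>

section \<open>The regularized integral along a vertical ray\<close>

lemma csqrt_neg_real: "u > 0 \<Longrightarrow> csqrt (- complex_of_real u) = \<i> * complex_of_real (sqrt u)"
  by (simp add: csqrt_of_real_nonpos flip: of_real_minus)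

text \<open>Integration by parts leaves a boundary term at \<open>t * s\<close>, which the
  counterterm completes to the difference of \<open>F\<close> at \<open>t * s\<close> and at 0. The
  result is split into two terms free of \<open>t\<close>, which form the limit, and two that vanish
  as \<open>t\<close> tends to 0.\<close>

lemma reg_approx_vertical:
  fixes f :: "complex \<Rightarrow> complex" and F' :: "real \<Rightarrow> complex"
  defines "F \<equiv> \<lambda>\<tau> u::real. f (\<tau> + \<i> * of_real u)"
  assumes s: "s > 0" and t: "0 < t" "t < 1"
    and D: "\<And>u. u \<in> {0..s} \<Longrightarrow> (F \<tau> has_vector_derivative F' u) (at u within {0..s})"
    and cont: "continuous_on {0..s} F'"
  shows "reg_approx \<tau> (\<tau> + \<i> * of_real s) f t =
           2 * F \<tau> s / sqrt s - 4 * integral {0..sqrt s} (\<lambda>x. F' (x\<^sup>2))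
           - 2 * (F \<tau> (t * s) - F \<tau> 0) / sqrt (t * s)
           + 4 * integral {0..sqrt (t * s)} (\<lambda>x. F' (x\<^sup>2))"
proof -
  define W where "W = (\<lambda>v. integral {0..v} (\<lambda>x. F' (x\<^sup>2)))"
  define P where "P = (\<lambda>u. - 2 * F \<tau> u / sqrt u + 4 * W (sqrt u))"
  define e where "e = t * s"
  have e: "0 < e" "e < s" using s t by (auto simp: e_def)
  have sqb: "x\<^sup>2 \<in> {0..s}" if "x \<in> {0..sqrt s}" for x
    using that s real_sqrt_le_iff[of "x\<^sup>2" s] by auto
  have contW: "continuous_on {0..sqrt s} (\<lambda>x. F' (x\<^sup>2))"
    by (rule continuous_on_compose2[OF cont]) (use sqb in \<open>auto intro!: continuous_intros\<close>)
  \<comment> \<open>\<open>P\<close> is the primitive found by integrating by parts and substituting \<open>u = v\<^sup>2\<close>.\<close>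
  have DP: "(P has_vector_derivative F \<tau> u / (of_real u * of_real (sqrt u))) (at u within {e..s})"
    if u: "u \<in> {e..s}" for u
  proof -
    have u0: "u > 0" using u e by auto
    have DF: "(F \<tau> has_vector_derivative F' u) (at u within {e..s})"
      by (rule has_vector_derivative_within_subset[OF D]) (use u e in auto)
    have Dsq: "(sqrt has_vector_derivative inverse (sqrt u) / 2) (at u within {e..s})"
      using DERIV_real_sqrt[OF u0]
      by (auto simp: has_real_derivative_iff_has_vector_derivative intro: has_vector_derivative_at_within)
    have "(W has_vector_derivative F' ((sqrt u)\<^sup>2)) (at (sqrt u) within {0..sqrt s})"
      unfolding W_def by (rule integral_has_vector_derivative[OF contW]) (use u u0 in auto)
    then have "(W has_vector_derivative F' u) (at (sqrt u) within sqrt ` {e..s})"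
      using u0 e by (auto intro: has_vector_derivative_within_subset)
    from vector_diff_chain_within[OF Dsq this]
    have DW: "((\<lambda>u. W (sqrt u)) has_vector_derivative (inverse (sqrt u) / 2) *\<^sub>R F' u) (at u within {e..s})"
      by (simp add: o_def)
    have Dis: "((\<lambda>u. inverse (sqrt u)) has_vector_derivative - (inverse (sqrt u) / (2 * u))) (at u within {e..s})"
      unfolding has_real_derivative_iff_has_vector_derivative[symmetric]
      using u0 by (auto intro!: derivative_eq_intros simp: field_simps)
    have "((\<lambda>u. - 2 * (inverse (sqrt u) *\<^sub>R F \<tau> u) + 4 * W (sqrt u)) has_vector_derivative
        - 2 * (inverse (sqrt u) *\<^sub>R F' u + (- (inverse (sqrt u) / (2 * u))) *\<^sub>R F \<tau> u)
        + 4 * ((inverse (sqrt u) / 2) *\<^sub>R F' u)) (at u within {e..s})"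
      by (intro has_vector_derivative_add has_vector_derivative_mult_right has_vector_derivative_scaleR DF DW)
         (use Dis in \<open>simp add: has_real_derivative_iff_has_vector_derivative\<close>)
    moreover have "- 2 * (inverse (sqrt u) *\<^sub>R F' u + (- (inverse (sqrt u) / (2 * u))) *\<^sub>R F \<tau> u)
        + 4 * ((inverse (sqrt u) / 2) *\<^sub>R F' u) = F \<tau> u / (of_real u * of_real (sqrt u))"
      using u0 by (simp add: scaleR_conv_of_real field_simps)
    moreover have "(\<lambda>u. - 2 * (inverse (sqrt u) *\<^sub>R F \<tau> u) + 4 * W (sqrt u)) = P"
      by (simp add: P_def scaleR_conv_of_real field_simps)
    ultimately show ?thesis by simp
  qed
  have "((\<lambda>u. F \<tau> u / (of_real u * of_real (sqrt u))) has_integral P s - P e) {e..s}"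
    by (rule fundamental_theorem_of_calculus) (use e DP in auto)
  then have "((\<lambda>u. \<i> * (F \<tau> u / (of_real u * of_real (sqrt u)))) has_integral \<i> * (P s - P e)) {e..s}"
    by (rule has_integral_mult_right)
  \<comment> \<open>On the ray the cube of \<open>csqrt\<close> is
    \<open>- \<i> * u * sqrt u\<close>, and its reciprocal supplies the factor \<open>\<i>\<close>
    carried in front.\<close>
  also have "?this \<longleftrightarrow> ((\<lambda>u. f (Complex (Re \<tau>) (Im \<tau> + u)) / csqrt (\<i> * (Complex (Re \<tau>) (Im \<tau> + u) - \<tau>)) ^ 3)
      has_integral \<i> * (P s - P e)) {e..s}"
  proof (rule has_integral_cong)
    fix u assume "u \<in> {e..s}"
    then have u0: "u > 0" using e by auto
    have c: "Complex (Re \<tau>) (Im \<tau> + u) = \<tau> + \<i> * of_real u" by (simp add: complex_eq_iff)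
    have "csqrt (\<i> * (Complex (Re \<tau>) (Im \<tau> + u) - \<tau>)) = csqrt (- of_real u)" by (simp add: c)
    also have "\<dots> ^ 3 = - \<i> * (of_real u * of_real (sqrt u))"
    proof -
      have "(\<i> * complex_of_real (sqrt u)) ^ 3 = - \<i> * ((complex_of_real (sqrt u) * of_real (sqrt u)) * of_real (sqrt u))"
        by (simp add: power3_eq_cube algebra_simps)
      also have "complex_of_real (sqrt u) * of_real (sqrt u) = of_real u"
        using u0 by (simp flip: of_real_mult)
      finally show ?thesis
        using u0 by (simp only: csqrt_neg_real)
    qed
    finally show "\<i> * (F \<tau> u / (of_real u * of_real (sqrt u))) =
      f (Complex (Re \<tau>) (Im \<tau> + u)) / csqrt (\<i> * (Complex (Re \<tau>) (Im \<tau> + u) - \<tau>)) ^ 3"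
      using u0 by (simp only: c F_def) (simp add: field_simps)
  qed
  \<comment> \<open>The value takes the shape \<open>- \<i> * I\<close>: for a contour integral
    \<open>I\<close>, this factor undoes the \<open>\<i>\<close> of
    \<open>dw = \<i> du\<close>.\<close>
  also have "\<dots> \<longleftrightarrow> ((\<lambda>x. f (Complex (Re \<tau>) x) / csqrt (\<i> * (Complex (Re \<tau>) x - \<tau>)) ^ 3)
      has_integral (- \<i> * - (P s - P e))) {Im \<tau> + e..Im \<tau> + s}"
    by (subst has_integral_shift_real_ivl_iff[where c = "Im \<tau>"]) (simp add: algebra_simps)
  also have "\<dots> \<longleftrightarrow> ((\<lambda>w2. f w2 / csqrt (\<i> * (w2 - \<tau>)) ^ 3) has_contour_integral - (P s - P e))
      (linepath (\<tau> + \<i> * e) (\<tau> + \<i> * s))"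
    by (subst has_contour_integral_linepath_same_Re_iff[where a = "Im \<tau> + e" and b = "Im \<tau> + s" and c = "Re \<tau>"])
       (use e in auto)
  finally have I: "contour_integral (linepath (\<tau> + \<i> * e) (\<tau> + \<i> * s)) (\<lambda>w2. f w2 / csqrt (\<i> * (w2 - \<tau>)) ^ 3) = P e - P s"
    by (simp add: contour_integral_unique)
  have g: "hyp_geodesic \<tau> (\<tau> + \<i> * s) = linepath \<tau> (\<tau> + \<i> * s)"
    by (simp add: hyp_geodesic_def)
  have sub: "subpath t 1 (linepath \<tau> (\<tau> + \<i> * s)) = linepath (\<tau> + \<i> * e) (\<tau> + \<i> * s)"
    by (simp add: subpath_def linepath_def e_def fun_eq_iff scaleR_conv_of_real algebra_simps)
  have gt: "\<i> * (linepath \<tau> (\<tau> + \<i> * s) t - \<tau>) = - of_real e"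
    by (simp add: linepath_def e_def scaleR_conv_of_real algebra_simps)
  have "reg_approx \<tau> (\<tau> + \<i> * of_real s) f t = P e - P s + 2 * F \<tau> 0 / sqrt e"
    unfolding reg_approx_def Let_def g sub I gt csqrt_neg_real[OF e(1)]
    using e by (simp add: F_def field_simps)
  also have "\<dots> = 2 * F \<tau> s / sqrt s - 4 * W (sqrt s) - 2 * (F \<tau> e - F \<tau> 0) / sqrt e + 4 * W (sqrt e)"
    using e s by (simp add: P_def field_simps)
  finally show ?thesis by (simp add: W_def e_def)
qed

text \<open>The quotient \<open>(F e - F 0) / sqrt e\<close> is \<open>sqrt e\<close> times a
  difference quotient, hence tends to 0, and the integral up to \<open>sqrt e\<close> shrinks to
  0.\<close>

lemma reg_approx_vertical_tendsto:
  fixes f :: "complex \<Rightarrow> complex" and F' :: "real \<Rightarrow> complex"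
  assumes s: "s > 0"
    and D: "\<And>u. u \<in> {0..s} \<Longrightarrow>
      ((\<lambda>u. f (\<tau> + \<i> * of_real u)) has_vector_derivative F' u) (at u within {0..s})"
    and cont: "continuous_on {0..s} F'"
  shows "(reg_approx \<tau> (\<tau> + \<i> * of_real s) f \<longlongrightarrow>
           2 * f (\<tau> + \<i> * of_real s) / sqrt s - 4 * integral {0..sqrt s} (\<lambda>x. F' (x\<^sup>2))) (at_right 0)"
proof -
  define F where "F = (\<lambda>u::real. f (\<tau> + \<i> * of_real u))"
  define W where "W = (\<lambda>v. integral {0..v} (\<lambda>x. F' (x\<^sup>2)))"
  define e where "e = (\<lambda>t. t * s)"
  have sqb: "x\<^sup>2 \<in> {0..s}" if "x \<in> {0..sqrt s}" for x
    using that s real_sqrt_le_iff[of "x\<^sup>2" s] by auto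
  have contW: "continuous_on {0..sqrt s} (\<lambda>x. F' (x\<^sup>2))"
    by (rule continuous_on_compose2[OF cont]) (use sqb in \<open>auto intro!: continuous_intros\<close>)
  have ev: "\<forall>\<^sub>F t in at_right 0. t \<in> {0<..<1::real}"
    by (rule eventually_at_right_real) simp
  \<comment> \<open>Differentiability of \<open>F\<close> at 0 and continuity of \<open>W\<close>
    are only one-sided, so the limits are taken inside \<open>{0..s}\<close> and
    \<open>{0..sqrt s}\<close>.\<close>
  have e_lim: "filterlim e (at 0 within {0..s}) (at_right 0)"
    unfolding filterlim_at
  proof
    show "(e \<longlongrightarrow> 0) (at_right 0)"
      unfolding e_def by (auto intro!: tendsto_eq_intros)
    show "\<forall>\<^sub>F t in at_right 0. e t \<in> {0..s} \<and> e t \<noteq> 0"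
      using ev by eventually_elim (use s in \<open>auto simp: e_def\<close>)
  qed
  have sq_lim: "((\<lambda>t. sqrt (e t)) \<longlongrightarrow> 0) (at_right 0)"
    unfolding e_def by (auto intro!: tendsto_eq_intros)
  have sq_lim': "filterlim (\<lambda>t. sqrt (e t)) (at 0 within {0..sqrt s}) (at_right 0)"
    unfolding filterlim_at using sq_lim
    using s by (auto intro!: eventually_mono[OF ev] simp: e_def mult_le_cancel_right1)
  have "((\<lambda>u. (1 / (u - 0)) *\<^sub>R (F u - F 0)) \<longlongrightarrow> F' 0) (at 0 within {0..s})"
  proof -
    have "((\<lambda>y. (1 / norm (y - 0)) *\<^sub>R (F y - (F 0 + (y - 0) *\<^sub>R F' 0))) \<longlongrightarrow> 0) (at 0 within {0..s})"
      using D[of 0] s unfolding F_def has_vector_derivative_def has_derivative_within by auto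
    also have "?this \<longleftrightarrow> ((\<lambda>y. (1 / (y - 0)) *\<^sub>R (F y - F 0) - F' 0) \<longlongrightarrow> 0) (at 0 within {0..s})"
      by (intro Lim_cong_within) (auto simp: algebra_simps)
    finally show ?thesis
      by (rule LIM_zero_cancel)
  qed
  from filterlim_compose[OF this e_lim]
  have "((\<lambda>t. of_real (sqrt (e t)) * ((1 / (e t - 0)) *\<^sub>R (F (e t) - F 0))) \<longlongrightarrow> of_real 0 * F' 0) (at_right 0)"
    by (intro tendsto_intros sq_lim)
  then have q: "((\<lambda>t. (F (e t) - F 0) / of_real (sqrt (e t))) \<longlongrightarrow> 0) (at_right 0)"
  proof (rule Lim_transform_eventually[where f = "\<lambda>t. of_real (sqrt (e t)) * ((1 / (e t - 0)) *\<^sub>R (F (e t) - F 0))", THEN tendsto_eq_rhs])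
    show "\<forall>\<^sub>F t in at_right 0. of_real (sqrt (e t)) * ((1 / (e t - 0)) *\<^sub>R (F (e t) - F 0)) = (F (e t) - F 0) / of_real (sqrt (e t))"
      using ev
    proof eventually_elim
      case (elim t)
      then have "e t > 0" using s by (auto simp: e_def)
      then have "complex_of_real (e t) = of_real (sqrt (e t)) * of_real (sqrt (e t))" "sqrt (e t) \<noteq> 0"
        by (simp_all flip: of_real_mult)
      then show ?case by (simp add: scaleR_conv_of_real field_simps)
    qed
  qed simp
  have "continuous_on {0..sqrt s} W"
    unfolding W_def by (intro indefinite_integral_continuous_1 integrable_continuous_real contW)
  then have "(W \<longlongrightarrow> W 0) (at 0 within {0..sqrt s})"
    using s by (auto simp: continuous_on_def)
  from filterlim_compose[OF this sq_lim'] have W0: "((\<lambda>t. W (sqrt (e t))) \<longlongrightarrow> 0) (at_right 0)"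
    by (simp add: W_def)
  have "((\<lambda>t. 2 * F s / sqrt s - 4 * W (sqrt s) - 2 * ((F (e t) - F 0) / sqrt (e t)) + 4 * W (sqrt (e t)))
     \<longlongrightarrow> 2 * F s / sqrt s - 4 * W (sqrt s) - 2 * 0 + 4 * 0) (at_right 0)"
    by (intro tendsto_intros q W0)
  then show ?thesis
  proof (rule Lim_transform_eventually[THEN tendsto_eq_rhs])
    show "\<forall>\<^sub>F t in at_right 0. 2 * F s / sqrt s - 4 * W (sqrt s) - 2 * ((F (e t) - F 0) / sqrt (e t)) + 4 * W (sqrt (e t))
       = reg_approx \<tau> (\<tau> + \<i> * of_real s) f t"
      using ev by eventually_elim
        (subst reg_approx_vertical[OF s _ _ D cont], auto simp: F_def W_def e_def)
  qed (simp add: F_def W_def)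
qed

section \<open>Laplace integrals and exponential series\<close>

text \<open>With \<open>t = sqrt (b / a)\<close> a primitive is
  \<open>arctan (t * x) / (a * t)\<close>. The factor \<open>b\<close> lets the formula cover
  \<open>b = 0\<close>, and it is the factor that differentiation in \<open>u\<close> leaves on each
  term of the series.\<close>

lemma integral_inverse_quadratic:
  fixes a b :: real
  assumes "a > 0" "b \<ge> 0"
  shows "b * integral {0..1} (\<lambda>x. 1 / (a + b * x\<^sup>2)) = sqrt (b / a) * arctan (sqrt (b / a))"
proof (cases "b = 0")
  case False
  define t where "t = sqrt (b / a)"
  have t: "t > 0" "b = a * t\<^sup>2" using assms False by (auto simp: t_def)
  have "((\<lambda>x. 1 / (a + b * x\<^sup>2)) has_integral arctan (t * 1) / (a * t) - arctan (t * 0) / (a * t)) {0..1}"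
  proof (rule fundamental_theorem_of_calculus)
    fix x :: real
    have nz: "1 + (t * x)\<^sup>2 \<noteq> 0"
      using zero_le_power2[of "t * x"] by linarith
    have "((\<lambda>x. arctan (t * x) / (a * t)) has_real_derivative (t * inverse (1 + (t * x)\<^sup>2)) / (a * t)) (at x within {0..1})"
      using t assms by (auto intro!: derivative_eq_intros)
    also have "(t * inverse (1 + (t * x)\<^sup>2)) / (a * t) = 1 / (a * (1 + (t * x)\<^sup>2))"
      using t assms nz by (simp only: divide_inverse) (simp add: mult.commute)
    also have "a * (1 + (t * x)\<^sup>2) = a + b * x\<^sup>2"
      using t by (simp add: power_mult_distrib algebra_simps)
    finally have "((\<lambda>x. arctan (t * x) / (a * t)) has_real_derivative 1 / (a + b * x\<^sup>2)) (at x within {0..1})" .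
    then show "((\<lambda>x. arctan (t * x) / (a * t)) has_vector_derivative 1 / (a + b * x\<^sup>2)) (at x within {0..1})"
      by (simp add: has_real_derivative_iff_has_vector_derivative)
  qed simp
  then have "integral {0..1} (\<lambda>x. 1 / (a + b * x\<^sup>2)) = arctan t / (a * t)"
    by (simp add: integral_unique)
  then show ?thesis using t assms unfolding t_def[symmetric] by (simp add: power2_eq_square)
qed simp

lemma set_integrable_exp_minus:
  assumes "c > 0"
  shows "set_integrable lborel {0<..} (\<lambda>s::real. exp (- s * c))"
    and "(LBINT s:{0<..}. exp (- s * c)) = 1 / c"
proof -
  have "((\<lambda>s. exp (- c * s)) has_integral exp (- c * 0) / c) {0..}"
    using assms by (rule has_integral_exp_minus_to_infinity)
  then have I: "((\<lambda>s. exp (- s * c)) has_integral 1 / c) {0<..}"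
  proof (subst has_integral_spike_set_eq[of _ "{0..}"])
    have "{x \<in> {0<..} - {0..}. exp (- x * c) \<noteq> 0} \<subseteq> {0}" "{x \<in> {0..} - {0<..}. exp (- x * c) \<noteq> 0} \<subseteq> {0}" by auto
    then show "negligible {x \<in> {0<..} - {0..}. exp (- x * c) \<noteq> 0}" "negligible {x \<in> {0..} - {0<..}. exp (- x * c) \<noteq> 0}"
      using negligible_subset[OF negligible_sing] by blast+
  qed (simp add: mult.commute)
  then have "(\<lambda>s. exp (- s * c)) absolutely_integrable_on {0<..}"
    by (intro nonnegative_absolutely_integrable_1) (auto simp: integrable_on_def)
  then show *: "set_integrable lborel {0<..} (\<lambda>s::real. exp (- s * c))"
    unfolding set_integrable_def
    by (subst (asm) integrable_completion) simp_all
  show "(LBINT s:{0<..}. exp (- s * c)) = 1 / c"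
    using set_borel_integral_eq_integral(2)[OF *] I by (simp add: integral_unique)
qed

text \<open>Integrating over \<open>s\<close> first gives \<open>1 / (a + b * x\<^sup>2)\<close>,
  which is continuous on \<open>{0..1}\<close> since \<open>a > 0\<close>. As the integrand is
  nonnegative, this yields joint integrability, and the order may be exchanged.\<close>

lemma laplace_Fubini:
  fixes a b :: real
  assumes ab: "a > 0" "b \<ge> 0"
  defines "K \<equiv> \<lambda>s. integral {0..1} (\<lambda>x. exp (- s * (a + b * x\<^sup>2)))"
  shows "set_integrable lborel {0<..} K"
    and "(LBINT s:{0<..}. K s) = integral {0..1} (\<lambda>x. 1 / (a + b * x\<^sup>2))"
proof -
  have pos: "a + b * x\<^sup>2 > 0" for x using ab by (intro add_pos_nonneg) auto
  define f where "f = (\<lambda>(x::real, s::real). indicator {0..1} x * (indicator {0<..} s * exp (- s * (a + b * x\<^sup>2))))"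
  have fm: "f \<in> borel_measurable (lborel \<Otimes>\<^sub>M lborel)" unfolding f_def by measurable
  have fnn: "norm (f z) = f z" for z by (auto simp: f_def indicator_def split: prod.splits)
  have "integral\<^sup>L lborel (\<lambda>s. f (x, s)) = indicator {0..1} x * (LBINT s:{0<..}. exp (- s * (a + b * x\<^sup>2)))" for x
    by (simp add: f_def set_lebesgue_integral_def)
  then have inner: "integral\<^sup>L lborel (\<lambda>s. f (x, s)) = indicator {0..1} x *\<^sub>R (1 / (a + b * x\<^sup>2))" for x
    unfolding set_integrable_exp_minus(2)[OF pos] by simp
  have seg: "set_integrable lborel {0..1} (\<lambda>x. 1 / (a + b * x\<^sup>2))"
    using pos by (intro borel_integrable_atLeastAtMost' continuous_intros) (auto simp: less_imp_neq[symmetric])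
  have int: "integrable (lborel \<Otimes>\<^sub>M lborel) f"
  proof (rule lborel_pair.Fubini_integrable[OF fm])
    show "integrable lborel (\<lambda>x. LBINT y. norm (f (x, y)))"
      using seg unfolding fnn inner set_integrable_def .
    show "AE x in lborel. integrable lborel (\<lambda>y. f (x, y))"
      using set_integrable_exp_minus(1)[OF pos] by (auto simp: f_def set_integrable_def)
  qed
  have K: "(LBINT x. f (x, s)) = indicator {0<..} s *\<^sub>R K s" for s
  proof -
    have "(LBINT x:{0..1}. exp (- s * (a + b * x\<^sup>2))) = K s"
      unfolding K_def
      by (intro set_borel_integral_eq_integral(2) borel_integrable_atLeastAtMost' continuous_intros)
    moreover have "(LBINT x. f (x, s)) = (LBINT x. indicator {0<..} s * (indicator {0..1} x *\<^sub>R exp (- s * (a + b * x\<^sup>2))))"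
      by (intro Bochner_Integration.integral_cong) (auto simp: f_def)
    ultimately show ?thesis by (simp add: set_lebesgue_integral_def)
  qed
  show "set_integrable lborel {0<..} K"
    using lborel_pair.integrable_snd[of "\<lambda>x s. f (x, s)"] int
    by (simp add: set_integrable_def K)
  have "(LBINT s:{0<..}. K s) = (LBINT s. LBINT x. f (x, s))"
    by (simp add: K set_lebesgue_integral_def)
  also have "\<dots> = (LBINT x. LBINT s. f (x, s))"
    using int by (intro lborel_pair.Fubini_integral) simp
  also have "\<dots> = (LBINT x:{0..1}. 1 / (a + b * x\<^sup>2))"
    by (simp add: inner set_lebesgue_integral_def)
  also have "\<dots> = integral {0..1} (\<lambda>x. 1 / (a + b * x\<^sup>2))"
    by (rule set_borel_integral_eq_integral(2)[OF seg])
  finally show "(LBINT s:{0<..}. K s) = integral {0..1} (\<lambda>x. 1 / (a + b * x\<^sup>2))" .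
qed

text \<open>The exponentials have norm at most 1 where the real part is nonnegative, so
  \<open>cb\<close> majorizes the series of derivatives. The results feed the hypotheses of
  \<open>reg_approx_vertical_tendsto\<close>.\<close>

lemma exp_series_has_vector_derivative:
  fixes c :: "nat \<Rightarrow> complex" and b :: "nat \<Rightarrow> real"
  assumes b: "\<And>n. b n \<ge> 0" and c: "summable (\<lambda>n. norm (c n))" and cb: "summable (\<lambda>n. norm (c n) * b n)"
  shows "\<And>u. u \<in> {0..} \<Longrightarrow> ((\<lambda>u. \<Sum>n. c n * exp (- b n * u)) has_vector_derivative
            (- (\<Sum>n. c n * b n * exp (- b n * u)))) (at u within {0..})"
    and "continuous_on {0..} (\<lambda>u. \<Sum>n. c n * b n * exp (- b n * u))"
proof -
  \<comment> \<open>Termwise differentiation is available over a field only, hence the complex half-plane, which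
    also covers the one-sided derivative at \<open>0\<close>.\<close>
  define S where "S = {z. Re z \<ge> 0}"
  define f where "f = (\<lambda>n z. c n * exp (- of_real (b n) * z))"
  define f' where "f' = (\<lambda>n z. - (c n * b n * exp (- of_real (b n) * z)))"
  have S: "convex S" unfolding S_def by (rule convex_halfspace_Re_ge)
  have bd: "norm (f' n z) \<le> norm (c n) * b n" if "z \<in> S" for n z
    using that b[of n] by (auto simp: f'_def norm_mult S_def intro!: mult_left_le)
  have lim: "uniform_limit S (\<lambda>n z. \<Sum>i<n. f' i z) (\<lambda>z. \<Sum>i. f' i z) sequentially"
    by (rule Weierstrass_m_test[OF _ cb]) (use bd in auto)
  have D: "(f n has_field_derivative f' n z) (at z within S)" for n z
    unfolding f_def f'_def by (auto intro!: derivative_eq_intros)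
  have "summable (\<lambda>n. f n 0)" using c by (auto simp: f_def intro: summable_norm_cancel)
  from has_field_derivative_series[OF S D lim _ this]
  obtain g where g: "\<And>z. z \<in> S \<Longrightarrow> (\<lambda>n. f n z) sums g z"
     "\<And>z. z \<in> S \<Longrightarrow> (g has_field_derivative (\<Sum>i. f' i z)) (at z within S)"
    by (auto simp: S_def)
  have f'_sum: "(\<Sum>i. f' i (of_real u)) = - (\<Sum>n. c n * b n * exp (- b n * u))" if "u \<ge> 0" for u
  proof -
    have "summable (\<lambda>n. f' n (of_real u))"
      by (rule summable_comparison_test[OF _ cb]) (use bd that in \<open>auto simp: S_def\<close>)
    then show ?thesis
      using suminf_minus[of "\<lambda>n. f' n (of_real u)"] by (simp add: f'_def flip: exp_of_real)
  qed
  show "((\<lambda>u. \<Sum>n. c n * exp (- b n * u)) has_vector_derivative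
            (- (\<Sum>n. c n * b n * exp (- b n * u)))) (at u within {0..})" if u: "u \<in> {0..}" for u :: real
  proof -
    have "((g \<circ> of_real) has_vector_derivative (1 * (\<Sum>i. f' i (of_real u)))) (at u within {0..})"
    proof (rule field_vector_diff_chain_within)
      show "(complex_of_real has_vector_derivative 1) (at u within {0..})"
        by (auto intro!: derivative_eq_intros)
      show "(g has_field_derivative (\<Sum>i. f' i (of_real u))) (at (of_real u) within of_real ` {0..})"
        by (rule DERIV_subset[OF g(2)]) (use u in \<open>auto simp: S_def\<close>)
    qed
    then have D: "((g \<circ> of_real) has_vector_derivative (- (\<Sum>n. c n * b n * exp (- b n * u)))) (at u within {0..})"
      using f'_sum[of u] u by simp
    have eq: "(g \<circ> of_real) v = (\<Sum>n. c n * exp (- b n * v))" if "v \<in> {0..}" for v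
      using g(1)[of "of_real v"] that by (simp add: S_def f_def sums_iff flip: exp_of_real)
    show ?thesis
      by (rule has_vector_derivative_transform[OF u eq[symmetric] D])
  qed
  have "continuous_on S (\<lambda>z. \<Sum>i. f' i z)"
    by (rule uniform_limit_theorem[OF _ lim])
       (auto intro!: continuous_intros always_eventually simp: f'_def)
  then have "continuous_on {0..} (\<lambda>u. - (\<Sum>i. f' i (of_real u)))"
    by (rule continuous_on_minus[OF continuous_on_compose2[of S _ "{0..}" of_real]]) (auto simp: S_def intro!: continuous_intros)
  then show "continuous_on {0..} (\<lambda>u. \<Sum>n. c n * b n * exp (- b n * u))"
    by (rule continuous_on_eq) (simp add: f'_sum)
qed

text \<open>Two exchanges occur, each with its own majorant: \<open>kb\<close> gives uniform
  convergence in \<open>x\<close> for fixed \<open>s > 0\<close>, and \<open>kt\<close> says that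
  the L1 norms over \<open>s\<close> are summable.\<close>

lemma integral_laplace_series:
  fixes k :: "nat \<Rightarrow> complex" and a b :: "nat \<Rightarrow> real"
  assumes a: "\<And>n. a n > 0" and b: "\<And>n. b n \<ge> 0"
    and kb: "summable (\<lambda>n. norm (k n) * b n)"
    and kt: "summable (\<lambda>n. norm (k n) * (sqrt (b n / a n) * arctan (sqrt (b n / a n))))"
  shows "((\<lambda>s. integral {0..1} (\<lambda>x. \<Sum>n. k n * b n * exp (- s * (a n + b n * x\<^sup>2)))) has_integral
           (\<Sum>n. k n * (sqrt (b n / a n) * arctan (sqrt (b n / a n))))) {0<..}"
proof -
  define K where "K = (\<lambda>n s. integral {0..1} (\<lambda>x. exp (- s * (a n + b n * x\<^sup>2))))"
  define f where "f = (\<lambda>n s. indicator {0<..} s *\<^sub>R (k n * b n * of_real (K n s)))"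
  have Kint: "integrable lborel (\<lambda>s. indicator {0<..} s *\<^sub>R K n s)" for n
    using laplace_Fubini(1)[OF a b] unfolding K_def set_integrable_def .
  have f_eq: "f n s = (k n * b n) * of_real (indicator {0<..} s *\<^sub>R K n s)" for n s
    by (simp add: f_def indicator_def)
  have Knn: "K n s \<ge> 0" for n s
    unfolding K_def by (intro integral_nonneg integrable_continuous_real continuous_intros) auto
  have int: "integrable lborel (f n)" for n
    unfolding f_eq by (intro integrable_mult_right integrable_of_real Kint)
  have KI: "b n * (LBINT s. indicator {0<..} s *\<^sub>R K n s) = sqrt (b n / a n) * arctan (sqrt (b n / a n))" for n
    using laplace_Fubini(2)[OF a b, of n n] integral_inverse_quadratic[OF a b, of n n]
    unfolding K_def set_lebesgue_integral_def by simp
  have If: "integral\<^sup>L lborel (f n) = k n * (sqrt (b n / a n) * arctan (sqrt (b n / a n)))" for n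
  proof -
    have "integral\<^sup>L lborel (f n) = (k n * b n) * of_real (LBINT s. indicator {0<..} s *\<^sub>R K n s)"
      unfolding f_eq by (simp only: integral_mult_right_zero integral_complex_of_real)
    also have "\<dots> = k n * of_real (b n * (LBINT s. indicator {0<..} s *\<^sub>R K n s))"
      by simp
    finally show ?thesis by (simp only: KI)
  qed
  have "norm (f n s) = (norm (k n) * b n) * (indicator {0<..} s *\<^sub>R K n s)" for n s
    using b[of n] Knn[of n s] by (simp add: f_def norm_mult)
  then have In: "(LBINT s. norm (f n s)) = norm (k n) * (sqrt (b n / a n) * arctan (sqrt (b n / a n)))" for n
    by (simp only: integral_mult_right_zero mult.assoc KI)
  \<comment> \<open>For \<open>s \<le> 0\<close> everything vanishes through the indicator; the
    content lies in \<open>s > 0\<close>, where \<open>K n s \<le> 1\<close>.\<close>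
  have sums: "(\<lambda>n. f n s) sums (indicator {0<..} s *\<^sub>R integral {0..1} (\<lambda>x. \<Sum>n. k n * b n * exp (- s * (a n + b n * x\<^sup>2))))"
    and summ: "summable (\<lambda>n. norm (f n s))" for s
  proof -
    have le1: "exp (- s * (a n + b n * x\<^sup>2)) \<le> 1" if "s > 0" for n x
      using that a[of n] b[of n] by (auto intro!: mult_nonneg_nonneg add_nonneg_nonneg simp: less_imp_le)
    have *: "summable (\<lambda>n. norm (f n s)) \<and> (\<lambda>n. f n s) sums integral {0..1} (\<lambda>x. \<Sum>n. k n * b n * exp (- s * (a n + b n * x\<^sup>2)))"
      if s: "s > 0"
    proof
      have Kle: "K n s \<le> 1" for n
      proof -
        have "K n s \<le> integral {0..1::real} (\<lambda>x. 1::real)"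
          unfolding K_def
          by (rule integral_le) (use le1[OF s] in \<open>auto intro!: integrable_continuous_real continuous_intros\<close>)
        then show ?thesis by simp
      qed
      show "summable (\<lambda>n. norm (f n s))"
        by (rule summable_comparison_test[OF _ kb])
           (use b Knn Kle s in \<open>auto simp: f_def norm_mult intro!: exI[of _ 0] mult_left_le\<close>)
      have "uniform_limit {0..1} (\<lambda>N x. \<Sum>n<N. k n * b n * exp (- s * (a n + b n * x\<^sup>2)))
          (\<lambda>x. \<Sum>n. k n * b n * exp (- s * (a n + b n * x\<^sup>2))) sequentially"
      proof (rule Weierstrass_m_test[OF _ kb])
        fix n and x :: real
        show "norm (k n * complex_of_real (b n) * complex_of_real (exp (- s * (a n + b n * x\<^sup>2)))) \<le> norm (k n) * b n"
          using le1[OF s, of n x] b[of n] by (simp only: norm_mult norm_of_real abs_exp_cancel abs_of_nonneg) (intro mult_left_le mult_nonneg_nonneg; simp)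
      qed
      then obtain I J where IJ: "\<And>N. ((\<lambda>x. \<Sum>n<N. k n * b n * exp (- s * (a n + b n * x\<^sup>2))) has_integral I N) {0..1}"
        "((\<lambda>x. \<Sum>n. k n * b n * exp (- s * (a n + b n * x\<^sup>2))) has_integral J) {0..1}"
        "(I \<longlongrightarrow> J) sequentially"
        by (rule uniform_limit_integral) (auto intro!: continuous_intros)
      have "((\<lambda>x. \<Sum>n<N. k n * b n * exp (- s * (a n + b n * x\<^sup>2))) has_integral (\<Sum>n<N. f n s)) {0..1}" for N
      proof (intro has_integral_sum)
        fix n assume "n \<in> {..<N}"
        have "((\<lambda>x. exp (- s * (a n + b n * x\<^sup>2))) has_integral K n s) {0..1}"
          unfolding K_def by (intro integrable_integral integrable_continuous_real continuous_intros)
        then have "((\<lambda>x. complex_of_real (exp (- s * (a n + b n * x\<^sup>2)))) has_integral of_real (K n s)) {0..1}"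
          by (rule has_integral_of_real)
        from has_integral_mult_right[OF this]
        show "((\<lambda>x. k n * b n * exp (- s * (a n + b n * x\<^sup>2))) has_integral f n s) {0..1}"
          using s by (simp add: f_def)
      qed simp
      with IJ(1) have "I = (\<lambda>N. \<Sum>n<N. f n s)" by (intro ext) (rule has_integral_unique)
      with IJ(3) have "(\<lambda>N. \<Sum>n<N. f n s) \<longlonglongrightarrow> J" by simp
      with IJ(2) show "(\<lambda>n. f n s) sums integral {0..1} (\<lambda>x. \<Sum>n. k n * b n * exp (- s * (a n + b n * x\<^sup>2)))"
        by (simp add: sums_def integral_unique)
    qed
    show "summable (\<lambda>n. norm (f n s))"
      using * by (cases "s > 0") (auto simp: f_def)
    show "(\<lambda>n. f n s) sums (indicator {0<..} s *\<^sub>R integral {0..1} (\<lambda>x. \<Sum>n. k n * b n * exp (- s * (a n + b n * x\<^sup>2))))"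
      using * by (cases "s > 0") (auto simp: f_def)
  qed
  have norms: "summable (\<lambda>n. LBINT s. norm (f n s))" unfolding In by (rule kt)
  have "integrable lborel (\<lambda>s. \<Sum>n. f n s)" "(LBINT s. \<Sum>n. f n s) = (\<Sum>n. integral\<^sup>L lborel (f n))"
    using int summ norms by (auto intro!: integrable_suminf integral_suminf)
  then have "((\<lambda>s. \<Sum>n. f n s) has_integral (\<Sum>n. integral\<^sup>L lborel (f n))) UNIV"
    using has_integral_integral_lborel by metis
  also have "(\<lambda>s. \<Sum>n. f n s) = (\<lambda>s. if s \<in> {0<..} then integral {0..1} (\<lambda>x. \<Sum>n. k n * b n * exp (- s * (a n + b n * x\<^sup>2))) else 0)"
    using sums by (simp add: fun_eq_iff sums_iff)
  finally show ?thesis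
    unfolding If by (simp only: has_integral_restrict_UNIV)
qed

section \<open>Sums over the hexagonal lattice coset\<close>

lemma arctan_sqrt3: "arctan (sqrt 3) = pi / 3"
  using arctan_unique[of "pi / 3" "sqrt 3"] tan_60 by simp

text \<open>The left side has derivative zero away from 0, so it is constant on each half-line; the
  values \<open>2 * pi / 3\<close> at 1 and \<open>- pi / 3\<close> at -1 fix the constants. For
  \<open>x = n\<^sub>2 / n\<^sub>1\<close> the sign becomes the product of signs in
  \<open>Psi\<close>.\<close>

lemma arctan_hexagonal:
  fixes x :: real
  assumes "x \<noteq> 0"
  shows "arctan ((1 + 2 * x) / sqrt 3) + arctan ((1 + 2 / x) / sqrt 3) = pi / 6 + pi / 2 * sgn x"
proof -
  define g where "g = (\<lambda>x. arctan ((1 + 2 * x) / sqrt 3) + arctan ((1 + 2 / x) / sqrt 3))"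
  have D: "(g has_real_derivative 0) (at y within S)" if "y \<noteq> 0" for y S
  proof -
    \<comment> \<open>Both squares lead to \<open>1 + y + y\<^sup>2\<close>; the divisor
      \<open>y\<^sup>2\<close> in the second cancels against the inner derivative
      \<open>- (2 / y\<^sup>2)\<close>.\<close>
    have 1: "1 + ((1 + 2 * y) / sqrt 3)\<^sup>2 = (4 / 3) * (1 + y + y\<^sup>2)"
      by (simp add: power_divide power2_eq_square field_simps)
    have 2: "1 + ((1 + 2 / y) / sqrt 3)\<^sup>2 = (4 / 3) * (1 + y + y\<^sup>2) / y\<^sup>2"
      using that by (simp add: power_divide power2_eq_square field_simps)
    have gen: "inverse q * (2 / c) + inverse (q / y\<^sup>2) * (- (2 / y\<^sup>2) / c) = 0" for q c
      using that by (cases "q = 0") (simp_all add: divide_simps)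
    have *: "inverse (1 + ((1 + 2 * y) / sqrt 3)\<^sup>2) * (2 / sqrt 3)
        + inverse (1 + ((1 + 2 / y) / sqrt 3)\<^sup>2) * (- (2 / y\<^sup>2) / sqrt 3) = 0"
      unfolding 1 2 using gen .
    have "(g has_real_derivative inverse (1 + ((1 + 2 * y) / sqrt 3)\<^sup>2) * (2 / sqrt 3)
        + inverse (1 + ((1 + 2 / y) / sqrt 3)\<^sup>2) * (- (2 / y\<^sup>2) / sqrt 3)) (at y within S)"
      unfolding g_def
    proof (intro DERIV_add DERIV_chain2[OF DERIV_arctan])
      have "((\<lambda>x. 1 + 2 * x) has_real_derivative 2) (at y within S)"
        by (auto intro!: derivative_eq_intros)
      then show "((\<lambda>x. (1 + 2 * x) / sqrt 3) has_real_derivative 2 / sqrt 3) (at y within S)"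
        by (rule DERIV_cdivide)
      have "((\<lambda>x. 1 + 2 / x) has_real_derivative - (2 / y\<^sup>2)) (at y within S)"
        using that by (auto intro!: derivative_eq_intros simp: power2_eq_square)
      then show "((\<lambda>x. (1 + 2 / x) / sqrt 3) has_real_derivative - (2 / y\<^sup>2) / sqrt 3) (at y within S)"
        by (rule DERIV_cdivide)
    qed
    then show ?thesis unfolding * .
  qed
  have const: "g x = g c" if "convex S" "x \<in> S" "c \<in> S" "0 \<notin> S" for c S
  proof -
    have "(g has_real_derivative 0) (at y within S)" if "y \<in> S" for y
      by (rule D) (use that \<open>0 \<notin> S\<close> in auto)
    from has_field_derivative_zero_constant[OF that(1) this]
    obtain k where "\<forall>y\<in>S. g y = k" by auto
    then show ?thesis using that by simp
  qed
  have three: "3 / sqrt 3 = sqrt 3" by (simp add: real_div_sqrt)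
  have one: "arctan (- 1 / sqrt 3) = - (pi / 6)"
    using arctan_unique[of "pi / 6" "1 / sqrt 3"] tan_30 by (simp add: arctan_minus)
  show ?thesis
  proof (cases "x > 0")
    case True
    then have "g x = g 1" by (intro const[of "{0<..}"]) auto
    then show ?thesis using True by (simp add: g_def three arctan_sqrt3)
  next
    case False
    then have "g x = g (- 1)" using assms by (intro const[of "{..<0}"]) auto
    also have "g (- 1) = - (pi / 3)" using one by (simp add: g_def)
    finally show ?thesis using False assms by (simp add: g_def)
  qed
qed

section \<open>Absolute convergence of Gaussian sums over cosets\<close>

lemma summable_on_UNIV_int:
  fixes f :: "int \<Rightarrow> real"
  assumes "\<And>i. f i \<ge> 0" "summable (\<lambda>n. f (int n))" "summable (\<lambda>n. f (- int n))"
  shows "f summable_on UNIV"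
proof -
  have "f summable_on range int"
    using assms norm_summable_imp_summable_on[of "\<lambda>n. f (int n)"]
    by (subst summable_on_reindex) (auto simp: o_def)
  moreover have "f summable_on range (\<lambda>n. - int n)"
    using assms norm_summable_imp_summable_on[of "\<lambda>n. f (- int n)"]
    by (subst summable_on_reindex) (auto simp: o_def inj_def)
  ultimately have "f summable_on (range int \<union> range (\<lambda>n. - int n))"
    by (rule summable_on_union)
  also have "range int \<union> range (\<lambda>n. - int n) = UNIV"
    using int_cases2 by (auto simp: image_iff) metis
  finally show ?thesis .
qed

text \<open>One term of the exponential series bounds the power by
  \<open>fact p * exp (1 + \<bar>n\<bar>)\<close>, and completing the square gives
  \<open>c * n\<^sup>2 \<ge> 2 * \<bar>n\<bar> - 1 / c\<close>. What remains is dominated by a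
  geometric series.\<close>

lemma gaussian_summable_on_int_coset:
  fixes a c :: real
  assumes "c > 0"
  shows "(\<lambda>n. (1 + \<bar>n\<bar>) ^ p * exp (- c * n\<^sup>2)) summable_on int_coset a"
proof -
  \<comment> \<open>\<open>fact p\<close> and \<open>exp 1\<close> come from the bound on the power,
    \<open>exp (1 / c)\<close> from the completed square, and \<open>exp \<bar>a\<bar>\<close> from
    \<open>\<bar>j\<bar> \<le> \<bar>n\<bar> + \<bar>a\<bar>\<close>.\<close>
  define C where "C = fact p * exp 1 * exp (1 / c) * exp \<bar>a\<bar>"
  have bound: "(1 + \<bar>n\<bar>) ^ p * exp (- c * n\<^sup>2) \<le> C * exp (- \<bar>real_of_int j\<bar>)" if "n = of_int j + a" for n j
  proof -
    have "(\<lambda>k. (1 + \<bar>n\<bar>) ^ k /\<^sub>R fact k) sums exp (1 + \<bar>n\<bar>)" by (rule exp_converges)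
    then have "(1 + \<bar>n\<bar>) ^ p /\<^sub>R fact p \<le> exp (1 + \<bar>n\<bar>)"
      using sum_le_suminf[of "\<lambda>k. (1 + \<bar>n\<bar>) ^ k /\<^sub>R fact k" "{p}"] by (auto simp: sums_iff)
    then have 1: "(1 + \<bar>n\<bar>) ^ p \<le> fact p * exp (1 + \<bar>n\<bar>)" by (simp add: field_simps)
    have "0 \<le> (c * \<bar>n\<bar> - 1)\<^sup>2 / c" using assms by simp
    also have "\<dots> = c * n\<^sup>2 - 2 * \<bar>n\<bar> + 1 / c"
      using assms by (simp add: power2_eq_square field_simps)
    finally have "1 + \<bar>n\<bar> - c * n\<^sup>2 \<le> 1 + 1 / c + \<bar>a\<bar> - \<bar>real_of_int j\<bar>" using that by linarith
    then have 2: "exp (1 + \<bar>n\<bar> - c * n\<^sup>2) \<le> exp (1 + 1 / c + \<bar>a\<bar> - \<bar>real_of_int j\<bar>)" by simp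
    have "(1 + \<bar>n\<bar>) ^ p * exp (- c * n\<^sup>2) \<le> fact p * exp (1 + \<bar>n\<bar>) * exp (- c * n\<^sup>2)"
      using 1 by (intro mult_right_mono) auto
    also have "\<dots> = fact p * exp (1 + \<bar>n\<bar> - c * n\<^sup>2)" by (simp add: exp_diff exp_minus field_simps)
    also have "\<dots> \<le> fact p * exp (1 + 1 / c + \<bar>a\<bar> - \<bar>real_of_int j\<bar>)" using 2 by (intro mult_left_mono) auto
    also have "\<dots> = C * exp (- \<bar>real_of_int j\<bar>)" by (simp add: C_def exp_add exp_diff exp_minus field_simps)
    finally show ?thesis .
  qed
  have geo: "summable (\<lambda>n. exp (- real n))"
    using summable_geometric[of "exp (- 1 :: real)"] by (simp add: exp_of_nat_mult[symmetric])
  have "(\<lambda>j::int. C * exp (- \<bar>real_of_int j\<bar>)) summable_on UNIV"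
    by (intro summable_on_UNIV_int) (auto simp: C_def intro: summable_mult geo)
  then have "(\<lambda>j::int. (1 + \<bar>of_int j + a\<bar>) ^ p * exp (- c * (of_int j + a)\<^sup>2)) summable_on UNIV"
    by (rule summable_on_comparison_test) (use bound in auto)
  moreover have "int_coset a = range (\<lambda>j. of_int j + a)" by (auto simp: int_coset_def)
  ultimately show ?thesis by (simp add: summable_on_reindex inj_def o_def)
qed

lemma has_sum_product_complex:
  fixes f g :: "_ \<Rightarrow> complex"
  assumes f: "(\<lambda>x. norm (f x)) summable_on A" and g: "(\<lambda>y. norm (g y)) summable_on B"
  shows "((\<lambda>(x, y). f x * g y) has_sum (infsum f A * infsum g B)) (A \<times> B)"
proof -
  have "(\<lambda>(x, y). norm (f x) * norm (g y)) summable_on A \<times> B"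
  proof (rule summable_on_SigmaI)
    show "((\<lambda>y. case (x, y) of (x, y) \<Rightarrow> norm (f x) * norm (g y)) has_sum norm (f x) * infsum (\<lambda>y. norm (g y)) B) B" for x
      using has_sum_cmult_right[OF has_sum_infsum[OF g]] by simp
    show "(\<lambda>x. norm (f x) * infsum (\<lambda>y. norm (g y)) B) summable_on A"
      using f by (rule summable_on_cmult_left)
  qed auto
  then have "(\<lambda>(x, y). f x * g y) summable_on A \<times> B"
    by (rule abs_summable_summable[OF iffD2[OF summable_on_cong, rotated]]) (auto simp: norm_mult)
  then show ?thesis
  proof (intro has_sum_SigmaI)
    show "((\<lambda>y. case (x, y) of (x, y) \<Rightarrow> f x * g y) has_sum f x * infsum g B) B" for x
      using has_sum_cmult_right[OF has_sum_infsum[OF abs_summable_summable[OF g]]] by simp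
    show "((\<lambda>x. f x * infsum g B) has_sum infsum f A * infsum g B) A"
      by (rule has_sum_cmult_left[OF has_sum_infsum[OF abs_summable_summable[OF f]]])
  qed
qed

lemma norm_qpow: "norm (qpow \<tau> x) = exp (- 2 * pi * Im \<tau> * x)"
  by (simp add: qpow_def)

lemma qpow_add: "qpow \<tau> (x + y) = qpow \<tau> x * qpow \<tau> y"
  by (simp add: qpow_def distrib_left exp_add)

lemma qpow_vertical: "qpow (\<tau> + \<i> * of_real s) x = qpow \<tau> x * exp (- (2 * pi * x) * s)"
proof -
  have "2 * of_real pi * \<i> * (\<tau> + \<i> * of_real s) * of_real x =
      2 * of_real pi * \<i> * \<tau> * of_real x + of_real (- (2 * pi * x) * s)"
    by (simp add: algebra_simps)
  then show ?thesis by (simp only: qpow_def exp_add exp_of_real)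
qed

lemma theta_abs_summable:
  assumes "Im \<tau> > 0" "m > 0"
  shows "(\<lambda>n. norm (of_real (n ^ k) * qpow \<tau> (of_nat m * n\<^sup>2))) summable_on int_coset a"
proof (rule summable_on_comparison_test)
  show "(\<lambda>n. (1 + \<bar>n\<bar>) ^ k * exp (- (2 * pi * Im \<tau> * m) * n\<^sup>2)) summable_on int_coset a"
    using assms by (intro gaussian_summable_on_int_coset) auto
  show "norm (of_real (n ^ k) * qpow \<tau> (of_nat m * n\<^sup>2)) \<le> (1 + \<bar>n\<bar>) ^ k * exp (- (2 * pi * Im \<tau> * m) * n\<^sup>2)" for n
    by (auto simp: norm_mult norm_qpow norm_power mult.assoc intro!: mult_right_mono power_mono)
qed auto

section \<open>The lattice coset and its symmetries\<close>

abbreviation (input) hex_lattice :: "(real \<times> real) set" where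
  "hex_lattice \<equiv> int_coset (1/3) \<times> int_coset (1/3)"

text \<open>The numbers -2/3 and 1/3 differ by an integer. This is what lets the permutations of the
  three coordinates act on \<open>hex_lattice\<close>.\<close>

lemma int_coset_third_neg_add:
  assumes "x \<in> int_coset (1/3)" "y \<in> int_coset (1/3)"
  shows "- x - y \<in> int_coset (1/3)"
proof -
  from assms obtain i j where "x = of_int i + 1/3" "y = of_int j + 1/3"
    by (auto simp: int_coset_def)
  then have "- x - y = of_int (- i - j - 1) + 1/3" by simp
  then show ?thesis unfolding int_coset_def by blast
qed

lemma int_coset_third_nonzero: "x \<in> int_coset (1/3) \<Longrightarrow> x \<noteq> 0"
proof
  assume "x \<in> int_coset (1/3)" "x = 0"
  then obtain i :: int where "of_int i + 1/3 = (0::real)" by (auto simp: int_coset_def)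
  then have "of_int (3 * i + 1) = (0::real)" by simp
  then have "3 * i + 1 = 0" by (simp only: of_int_eq_0_iff)
  then show False by presburger
qed

lemma hex_form_ge: "(x\<^sup>2 + y\<^sup>2) / 2 \<le> x\<^sup>2 + x * y + y\<^sup>2" for x y :: real
  using zero_le_power2[of "x + y"] by (simp add: power2_eq_square algebra_simps)

text \<open>By \<open>hex_form_ge\<close> each term is dominated by a product of two one-variable
  Gaussians; the factor 1/2 lost there turns the rate \<open>2 * pi * Im \<tau>\<close> into
  \<open>c\<close>.\<close>

lemma hex_gaussian_summable_on:
  fixes g :: "real \<Rightarrow> real \<Rightarrow> real"
  assumes "Im \<tau> > 0" and g: "\<And>x y. \<bar>g x y\<bar> \<le> C * ((1 + \<bar>x\<bar>) ^ p * (1 + \<bar>y\<bar>) ^ p)"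
  shows "(\<lambda>(x, y). norm (of_real (g x y) * qpow \<tau> (x\<^sup>2 + x * y + y\<^sup>2))) summable_on hex_lattice"
proof -
  define c where "c = pi * Im \<tau>"
  define e where "e = (\<lambda>x. (1 + \<bar>x\<bar>) ^ p * exp (- c * x\<^sup>2))"
  have c: "c > 0" using assms by (simp add: c_def)
  have e: "e summable_on int_coset (1/3)"
    unfolding e_def by (rule gaussian_summable_on_int_coset[OF c])
  have enn: "e x \<ge> 0" for x by (simp add: e_def)
  have C: "C \<ge> 0" using g[of 0 0] by simp
  have "(\<lambda>(x, y). (C * e x) * e y) summable_on hex_lattice"
  proof (rule summable_on_SigmaI)
    show "((\<lambda>y. case (x, y) of (x, y) \<Rightarrow> C * e x * e y) has_sum C * e x * infsum e (int_coset (1/3))) (int_coset (1/3))" for x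
      using e by (auto intro!: has_sum_cmult_right has_sum_infsum)
    show "(\<lambda>x. C * e x * infsum e (int_coset (1/3))) summable_on int_coset (1/3)"
      using e by (intro summable_on_cmult_left summable_on_cmult_right)
  qed (use enn C in auto)
  then show ?thesis
  proof (rule summable_on_comparison_test; clarify)
    fix x y
    have "- 2 * pi * Im \<tau> * (x\<^sup>2 + x * y + y\<^sup>2) \<le> - c * x\<^sup>2 + - c * y\<^sup>2"
      using mult_left_mono[OF hex_form_ge[of x y], of "2 * c"] c by (simp add: c_def algebra_simps)
    then have "norm (qpow \<tau> (x\<^sup>2 + x * y + y\<^sup>2)) \<le> exp (- c * x\<^sup>2) * exp (- c * y\<^sup>2)"
      unfolding norm_qpow exp_add[symmetric] by (simp only: exp_le_cancel_iff)
    then have "norm (of_real (g x y) * qpow \<tau> (x\<^sup>2 + x * y + y\<^sup>2))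
        \<le> (C * ((1 + \<bar>x\<bar>) ^ p * (1 + \<bar>y\<bar>) ^ p)) * (exp (- c * x\<^sup>2) * exp (- c * y\<^sup>2))"
      unfolding norm_mult norm_of_real using g C by (intro mult_mono) auto
    then show "norm (of_real (g x y) * qpow \<tau> (x\<^sup>2 + x * y + y\<^sup>2)) \<le> C * e x * e y"
      by (simp add: e_def mult_ac)
  qed auto
qed

text \<open>The weight is a separate argument so that the symmetries can act on it and identities
  between weights pass to the sums.\<close>

definition hexsum :: "complex \<Rightarrow> (real \<Rightarrow> real \<Rightarrow> real) \<Rightarrow> complex" where
  "hexsum \<tau> g = (\<Sum>\<^sub>\<infinity>(x, y)\<in>hex_lattice. of_real (g x y) * qpow \<tau> (x\<^sup>2 + x * y + y\<^sup>2))"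

lemma hexsum_swap: "hexsum \<tau> (\<lambda>x y. g y x) = hexsum \<tau> g"
  unfolding hexsum_def
  by (rule infsum_reindex_bij_witness[of _ prod.swap prod.swap])
     (auto simp: algebra_simps)

text \<open>The substitution shifts the triple \<open>(x, y, - x - y)\<close> cyclically, and the
  form is half the sum of the squares of its entries.\<close>

lemma hexsum_rotate: "hexsum \<tau> (\<lambda>x y. g y (- x - y)) = hexsum \<tau> g"
  unfolding hexsum_def
  by (rule infsum_reindex_bij_witness[of _ "\<lambda>(x, y). (- x - y, x)" "\<lambda>(x, y). (y, - x - y)"])
     (auto simp: int_coset_third_neg_add power2_eq_square algebra_simps)

lemma hexsum_cong:
  assumes "\<And>x y. x \<in> int_coset (1/3) \<Longrightarrow> y \<in> int_coset (1/3) \<Longrightarrow> g x y = g' x y"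
  shows "hexsum \<tau> g = hexsum \<tau> g'"
  unfolding hexsum_def by (rule infsum_cong) (use assms in auto)

lemma hexsum_cmult: "hexsum \<tau> (\<lambda>x y. c * g x y) = of_real c * hexsum \<tau> g"
  unfolding hexsum_def infsum_cmult_right'[symmetric]
  by (rule infsum_cong) auto

text \<open>Linear growth suffices for absolute convergence, holds for the coordinate, sign and
  arctangent weights, and is stable under sums, scaling and the symmetries. It is the side condition
  for additivity of \<open>hexsum\<close>.\<close>

definition hex_bounded :: "(real \<Rightarrow> real \<Rightarrow> real) \<Rightarrow> bool" where
  "hex_bounded g \<longleftrightarrow> (\<exists>C. \<forall>x y. \<bar>g x y\<bar> \<le> C * (\<bar>x\<bar> + \<bar>y\<bar>))"

lemma hex_boundedI: "(\<And>x y. \<bar>g x y\<bar> \<le> C * (\<bar>x\<bar> + \<bar>y\<bar>)) \<Longrightarrow> hex_bounded g"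
  by (auto simp: hex_bounded_def)

lemma hex_bounded_summable:
  assumes "Im \<tau> > 0" "hex_bounded g"
  shows "(\<lambda>(x, y). norm (of_real (g x y) * qpow \<tau> (x\<^sup>2 + x * y + y\<^sup>2))) summable_on hex_lattice"
proof -
  obtain C where C: "\<And>x y. \<bar>g x y\<bar> \<le> C * (\<bar>x\<bar> + \<bar>y\<bar>)" using assms by (auto simp: hex_bounded_def)
  have C0: "C \<ge> 0" using C[of 1 0] by simp
  show ?thesis
  proof (rule hex_gaussian_summable_on[OF assms(1), where C = C and p = 1])
    fix x y :: real
    have "\<bar>x\<bar> + \<bar>y\<bar> \<le> (1 + \<bar>x\<bar>) * (1 + \<bar>y\<bar>)" by (simp add: algebra_simps)
    from mult_left_mono[OF this C0]
    show "\<bar>g x y\<bar> \<le> C * ((1 + \<bar>x\<bar>) ^ 1 * (1 + \<bar>y\<bar>) ^ 1)" using C[of x y] by simp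
  qed
qed

lemma hex_bounded_summable':
  assumes "Im \<tau> > 0" "hex_bounded g"
  shows "(\<lambda>(x, y). of_real (g x y) * qpow \<tau> (x\<^sup>2 + x * y + y\<^sup>2)) summable_on hex_lattice"
  by (rule abs_summable_summable) (use hex_bounded_summable[OF assms] in \<open>simp add: case_prod_unfold\<close>)

lemma hex_bounded_add:
  assumes "hex_bounded g" "hex_bounded g'"
  shows "hex_bounded (\<lambda>x y. g x y + g' x y)"
proof -
  obtain C D where C: "\<And>x y. \<bar>g x y\<bar> \<le> C * (\<bar>x\<bar> + \<bar>y\<bar>)" and D: "\<And>x y. \<bar>g' x y\<bar> \<le> D * (\<bar>x\<bar> + \<bar>y\<bar>)"
    using assms by (auto simp: hex_bounded_def)
  show ?thesis
    by (rule hex_boundedI[where C = "C + D"])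
       (use C D in \<open>force simp: distrib_right intro: order_trans[OF abs_triangle_ineq add_mono]\<close>)
qed

lemma hexsum_add:
  assumes "Im \<tau> > 0" "hex_bounded g" "hex_bounded g'"
  shows "hexsum \<tau> (\<lambda>x y. g x y + g' x y) = hexsum \<tau> g + hexsum \<tau> g'"
proof -
  from infsum_add[OF assms(2,3)[THEN hex_bounded_summable'[OF assms(1)]]] show ?thesis
    unfolding hexsum_def by (simp add: case_prod_unfold distrib_right)
qed

lemma hex_bounded_cmult:
  assumes "hex_bounded g"
  shows "hex_bounded (\<lambda>x y. c * g x y)"
proof -
  obtain C where C: "\<And>x y. \<bar>g x y\<bar> \<le> C * (\<bar>x\<bar> + \<bar>y\<bar>)" using assms by (auto simp: hex_bounded_def)
  show ?thesis
    by (rule hex_boundedI[where C = "\<bar>c\<bar> * C"])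
       (use mult_left_mono[OF C, of "\<bar>c\<bar>"] in \<open>auto simp: abs_mult mult.assoc\<close>)
qed

lemma hex_bounded_swap: "hex_bounded g \<Longrightarrow> hex_bounded (\<lambda>x y. g y x)"
  unfolding hex_bounded_def by (metis add.commute)

lemma hex_bounded_rotate:
  assumes "hex_bounded g"
  shows "hex_bounded (\<lambda>x y. g y (- x - y))"
proof -
  obtain C where C: "\<And>x y. \<bar>g x y\<bar> \<le> C * (\<bar>x\<bar> + \<bar>y\<bar>)" using assms by (auto simp: hex_bounded_def)
  have C0: "C \<ge> 0" using C[of 1 0] by simp
  show ?thesis
  proof (rule hex_boundedI[where C = "2 * C"])
    fix x y :: real
    have "\<bar>y\<bar> + \<bar>- x - y\<bar> \<le> 2 * (\<bar>x\<bar> + \<bar>y\<bar>)" by (auto simp: abs_if)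
    from mult_left_mono[OF this C0] show "\<bar>g y (- x - y)\<bar> \<le> 2 * C * (\<bar>x\<bar> + \<bar>y\<bar>)"
      using C[of y "- x - y"] by (simp add: mult_ac)
  qed
qed

text \<open>By symmetry the three coordinates have the same sum \<open>X\<close>, while they add up
  to zero at each point, so \<open>X = - X - X\<close>.\<close>

lemma hexsum_fst:
  assumes "Im \<tau> > 0"
  shows "hexsum \<tau> (\<lambda>x y. x) = 0"
proof -
  define X where "X = hexsum \<tau> (\<lambda>x y. x)"
  have b: "hex_bounded (\<lambda>x y. x)" by (rule hex_boundedI[where C = 1]) auto
  have Y: "hexsum \<tau> (\<lambda>x y. y) = X" unfolding X_def by (rule hexsum_swap)
  have "X = hexsum \<tau> (\<lambda>x y. - x - y)"
    using hexsum_rotate[of \<tau> "\<lambda>x y. y"] Y by simp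
  also have "\<dots> = hexsum \<tau> (\<lambda>x y. (- 1) * x + (- 1) * y)" by simp
  also have "\<dots> = - X - X"
    using hexsum_add[OF assms hex_bounded_cmult[OF b, of "- 1"] hex_bounded_cmult[OF hex_bounded_swap[OF b], of "- 1"]]
    by (simp only: hexsum_cmult Y flip: X_def) simp
  finally show ?thesis by (simp add: X_def)
qed

section \<open>Evaluation of the arctangent sum\<close>

lemma hex_bounded_arctan:
  "hex_bounded (\<lambda>x y. (2 * y + x) / 2 * arctan ((2 * y + x) / (sqrt 3 * x)))"
proof (rule hex_boundedI[where C = 2])
  fix x y :: real
  define t where "t = arctan ((2 * y + x) / (sqrt 3 * x))"
  have "\<bar>t\<bar> \<le> 2"
    using arctan_bounded[of "(2 * y + x) / (sqrt 3 * x)"] pi_less_4 unfolding t_def by (auto simp: abs_le_iff)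
  then have "\<bar>(2 * y + x) / 2 * t\<bar> \<le> \<bar>(2 * y + x) / 2\<bar> * 2"
    unfolding abs_mult by (intro mult_left_mono) auto
  also have "\<dots> \<le> 2 * (\<bar>x\<bar> + \<bar>y\<bar>)" by (auto simp: abs_if field_simps)
  finally show "\<bar>(2 * y + x) / 2 * t\<bar> \<le> 2 * (\<bar>x\<bar> + \<bar>y\<bar>)" .
qed

text \<open>Under cyclic shifts the arctangents change by the constants of
  \<open>arctan_hexagonal\<close>, while their linear factors add up to zero. Summing over the three
  shifts therefore eliminates the arctangents and keeps products of signs.\<close>

lemma hexsum_arctan:
  assumes "Im \<tau> > 0"
  shows "hexsum \<tau> (\<lambda>x y. (2 * y + x) / 2 * arctan ((2 * y + x) / (sqrt 3 * x))) = pi / 2 * Psi \<tau>"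
proof -
  define \<alpha> where "\<alpha> = (\<lambda>x y::real. arctan ((2 * y + x) / (sqrt 3 * x)))"
  define A where "A = (\<lambda>x y::real. (2 * y + x) / 2 * \<alpha> x y)"
  define B where "B = (\<lambda>x y::real. sgn x * sgn y * x)"
  have Psi: "Psi \<tau> = hexsum \<tau> B"
    unfolding Psi_def hexsum_def Psi_term_def B_def ..
  have bx: "hex_bounded (\<lambda>x y. x)" by (rule hex_boundedI[where C = 1]) auto
  have bB: "hex_bounded B"
    by (rule hex_boundedI[where C = 1]) (auto simp: B_def abs_mult sgn_if)
  have bA: "hex_bounded A"
    using hex_bounded_arctan by (simp only: A_def \<alpha>_def)
  have \<alpha>: "\<alpha> x y - \<alpha> y (- x - y) = pi / 6 + pi / 2 * (sgn x * sgn y)" if "x \<noteq> 0" "y \<noteq> 0" for x y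
  proof -
    have "(2 * y + x) / (c * x) = (1 + 2 * (y / x)) / c" if "c \<noteq> 0" for c
      using that \<open>x \<noteq> 0\<close> by (simp add: field_simps)
    then have "\<alpha> x y = arctan ((1 + 2 * (y / x)) / sqrt 3)"
      by (simp only: \<alpha>_def) simp
    moreover have "(2 * (- x - y) + y) / (c * y) = - ((1 + 2 / (y / x)) / c)" if "c \<noteq> 0" for c
      using that \<open>x \<noteq> 0\<close> \<open>y \<noteq> 0\<close> by (simp add: field_simps)
    from this[of "sqrt 3"] have "\<alpha> y (- x - y) = - arctan ((1 + 2 / (y / x)) / sqrt 3)"
      by (simp add: \<alpha>_def flip: arctan_minus)
    ultimately show ?thesis
      using arctan_hexagonal[of "y / x"] that by (simp add: sgn_divide mult.commute)
  qed
  \<comment> \<open>As operators on weights, the shift \<open>r\<close> and the transposition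
    \<open>t\<close> can be iterated, and \<open>rt\<close> strips them from the sums.\<close>
  define r :: "(real \<Rightarrow> real \<Rightarrow> real) \<Rightarrow> real \<Rightarrow> real \<Rightarrow> real" where "r = (\<lambda>g x y. g y (- x - y))"
  define t :: "(real \<Rightarrow> real \<Rightarrow> real) \<Rightarrow> real \<Rightarrow> real \<Rightarrow> real" where "t = (\<lambda>g x y. g y x)"
  have rt: "hexsum \<tau> (r g) = hexsum \<tau> g" "hexsum \<tau> (t g) = hexsum \<tau> g" for g
    unfolding r_def t_def by (rule hexsum_rotate hexsum_swap)+
  have brt: "hex_bounded g \<Longrightarrow> hex_bounded (r g)" "hex_bounded g \<Longrightarrow> hex_bounded (t g)" for g
    unfolding r_def t_def by (erule hex_bounded_rotate hex_bounded_swap)+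
  note b = hex_bounded_add hex_bounded_cmult brt bA bB bx
  \<comment> \<open>The four sign weights are images of \<open>B\<close> under permutations, so each
    has the sum of \<open>B\<close>, with coefficients adding up to \<open>3 * pi / 2\<close>. The
    remaining weight is the third coordinate and sums to 0.\<close>
  have "hexsum \<tau> (\<lambda>x y. A x y + r A x y + r (r A) x y) =
     hexsum \<tau> (\<lambda>x y. pi / 4 * r (r (\<lambda>x y. x)) x y + (pi / 2 * r (t B) x y + pi / 4 * r B x y
        + (pi / 2 * r (r B) x y + pi / 4 * r (r (t B)) x y)))"
  proof (rule hexsum_cong)
    fix x y :: real assume xy: "x \<in> int_coset (1/3)" "y \<in> int_coset (1/3)"
    define z where "z = - x - y"
    have nz: "x \<noteq> 0" "y \<noteq> 0" "z \<noteq> 0"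
      using xy int_coset_third_neg_add[OF xy] unfolding z_def by (blast dest: int_coset_third_nonzero)+
    have c: "- y - z = x" "- z - x = y" by (auto simp: z_def)
    define u v w where "u = \<alpha> x y" and "v = \<alpha> y z" and "w = \<alpha> z x"
    \<comment> \<open>Only \<open>w\<close> is kept; its total coefficient is
      \<open>3 * (x + y + z) / 2\<close>, which is 0.\<close>
    have e: "v = w + (pi / 6 + pi / 2 * (sgn y * sgn z))" "u = w - (pi / 6 + pi / 2 * (sgn z * sgn x))"
      using \<alpha>[of y z] \<alpha>[of z x] nz c by (simp_all add: u_def v_def w_def)
    have "A x y + r A x y + r (r A) x y = A x y + A y z + A z x"
      by (simp add: r_def z_def)
    also have "\<dots> = (2 * y + x) / 2 * u + (2 * z + y) / 2 * v + (2 * x + z) / 2 * w"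
      by (simp add: A_def u_def v_def w_def)
    also have "\<dots> = pi / 4 * z + (pi / 2 * B z y + pi / 4 * B y z + (pi / 2 * B z x + pi / 4 * B x z))"
    proof -
      have "(2 * y + x) / 2 * (w - (pi / 6 + pi / 2 * q)) + (2 * z + y) / 2 * (w + (pi / 6 + pi / 2 * p)) + (2 * x + z) / 2 * w
        = pi / 4 * z + (pi / 2 * (p * z) + pi / 4 * (p * y) + (pi / 2 * (q * z) + pi / 4 * (q * x)))" for p q
        unfolding z_def by (simp add: field_simps)
      from this[of "sgn z * sgn x" "sgn y * sgn z"] show ?thesis
        unfolding e B_def by (simp only: mult.commute[of "sgn z" "sgn y"] mult.commute[of "sgn x" "sgn z"])
    qed
    also have "\<dots> = pi / 4 * r (r (\<lambda>x y. x)) x y + (pi / 2 * r (t B) x y + pi / 4 * r B x y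
        + (pi / 2 * r (r B) x y + pi / 4 * r (r (t B)) x y))"
      by (simp add: r_def t_def z_def)
    finally show "A x y + r A x y + r (r A) x y = \<dots>" .
  qed
  also have "hexsum \<tau> (\<lambda>x y. A x y + r A x y + r (r A) x y) = 3 * hexsum \<tau> A"
    by (simp only: hexsum_add[OF assms] b rt) simp
  also have "hexsum \<tau> (\<lambda>x y. pi / 4 * r (r (\<lambda>x y. x)) x y + (pi / 2 * r (t B) x y + pi / 4 * r B x y
        + (pi / 2 * r (r B) x y + pi / 4 * r (r (t B)) x y))) = 3 * (pi / 2 * hexsum \<tau> B)"
    by (simp only: hexsum_add[OF assms] b rt hexsum_cmult hexsum_fst[OF assms]) simp
  finally have "hexsum \<tau> A = pi / 2 * Psi \<tau>"
    by (simp add: Psi mult.commute)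
  then show ?thesis
    by (simp only: A_def \<alpha>_def)
qed

section \<open>The double integral\<close>

text \<open>The coordinates \<open>x / 2\<close> and \<open>y + x / 2\<close> diagonalize the form,
  giving the exponents \<open>3 * n\<^sup>2\<close> and \<open>l\<^sup>2\<close> of the two theta
  functions; the parity of \<open>x - 1/3\<close> decides which cosets they run through.\<close>

lemma has_sum_h:
  assumes w: "Im w1 > 0" "Im w2 > 0"
  shows "((\<lambda>(x, y). of_real (x / 2) * (qpow w1 (3 * (x / 2)\<^sup>2) * qpow w2 ((y + x / 2)\<^sup>2)))
            has_sum h w1 w2) hex_lattice"
proof -
  define G where "G = (\<lambda>(x, y). of_real (x / 2) * (qpow w1 (3 * (x / 2)\<^sup>2) * qpow w2 ((y + x / 2)\<^sup>2)))"
  define f where "f = (\<lambda>n. of_real (n ^ 1) * qpow w1 (of_nat 3 * n\<^sup>2))"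
  define g where "g = (\<lambda>n. of_real (n ^ 0) * qpow w2 (of_nat 1 * n\<^sup>2))"
  \<comment> \<open>The two products of theta functions are the parts of the coset with \<open>n\<^sub>1 - 1/3\<close> even and odd.\<close>
  define L0 :: "(real \<times> real) set" where "L0 = {(x, y). (\<exists>j::int. x = 2 * of_int j + 1/3) \<and> y \<in> int_coset (1/3)}"
  define L1 :: "(real \<times> real) set" where "L1 = {(x, y). (\<exists>j::int. x = 2 * of_int j + 4/3) \<and> y \<in> int_coset (1/3)}"
  have product: "((\<lambda>(x, y). f x * g y) has_sum infsum f (int_coset r) * infsum g (int_coset r'))
      (int_coset r \<times> int_coset r')" for r r'
    unfolding f_def g_def by (intro has_sum_product_complex theta_abs_summable w) auto
  have th: "infsum f (int_coset (1/6)) = theta 3 1 1 w1" "infsum g (int_coset (1/2)) = theta 1 1 0 w2"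
    "infsum f (int_coset (1/3)) = theta 3 2 1 w1" "infsum g (int_coset 0) = theta 1 0 0 w2"
    by (simp_all add: theta_def f_def g_def)
  have "((\<lambda>(x, y). f x * g y) has_sum theta 3 1 1 w1 * theta 1 1 0 w2) (int_coset (1/6) \<times> int_coset (1/2))"
    unfolding th[symmetric] by (rule product)
  also have "?this \<longleftrightarrow> (G has_sum theta 3 1 1 w1 * theta 1 1 0 w2) L0"
  proof (rule has_sum_reindex_bij_witness[of _ "\<lambda>(x, y). (x / 2, y + x / 2)" "\<lambda>(n, l). (2 * n, l - n)"])
    fix p :: "real \<times> real" assume "p \<in> int_coset (1/6) \<times> int_coset (1/2)"
    then obtain i j :: int where p: "p = (of_int i + 1/6, of_int j + 1/2)" by (auto simp: int_coset_def)
    have "2 * (real_of_int i + 1/6) = 2 * of_int i + 1/3" "real_of_int j + 1/2 - (of_int i + 1/6) = of_int (j - i) + 1/3"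
      by simp_all
    then show "(case p of (n, l) \<Rightarrow> (2 * n, l - n)) \<in> L0" unfolding L0_def p int_coset_def prod.case mem_Collect_eq by blast
  next
    fix p :: "real \<times> real" assume "p \<in> L0"
    then obtain i j :: int where p: "p = (2 * of_int i + 1/3, of_int j + 1/3)" by (auto simp: L0_def int_coset_def)
    have "(2 * real_of_int i + 1/3) / 2 = of_int i + 1/6" "real_of_int j + 1/3 + (2 * of_int i + 1/3) / 2 = of_int (i + j) + 1/2"
      by (simp_all add: field_simps)
    then show "(case p of (x, y) \<Rightarrow> (x / 2, y + x / 2)) \<in> int_coset (1/6) \<times> int_coset (1/2)"
      unfolding p int_coset_def prod.case mem_Sigma_iff mem_Collect_eq by blast
  qed (auto simp: G_def f_def g_def)
  finally have 0: "(G has_sum theta 3 1 1 w1 * theta 1 1 0 w2) L0" .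
  have "((\<lambda>(x, y). f x * g y) has_sum theta 3 2 1 w1 * theta 1 0 0 w2) (int_coset (1/3) \<times> int_coset 0)"
    unfolding th[symmetric] by (rule product)
  also have "?this \<longleftrightarrow> ((\<lambda>p. - G p) has_sum theta 3 2 1 w1 * theta 1 0 0 w2) L1"
  \<comment> \<open>Here \<open>x / 2\<close> lies in 2/3 plus the integers, so
    \<open>n = - x / 2\<close> is used to reach the coset of 1/3. The odd factor \<open>n\<close>
    changes sign, which accounts for the minus sign in \<open>h\<close>.\<close>
  proof (rule has_sum_reindex_bij_witness[of _ "\<lambda>(x, y). (- x / 2, y + x / 2)" "\<lambda>(n, l). (- 2 * n, l + n)"])
    fix p :: "real \<times> real" assume "p \<in> int_coset (1/3) \<times> int_coset 0"
    then obtain i j :: int where p: "p = (of_int i + 1/3, of_int j + 0)" by (auto simp: int_coset_def)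
    have "- 2 * (real_of_int i + 1/3) = 2 * of_int (- i - 1) + 4/3" "real_of_int j + 0 + (of_int i + 1/3) = of_int (i + j) + 1/3"
      by simp_all
    then show "(case p of (n, l) \<Rightarrow> (- 2 * n, l + n)) \<in> L1" unfolding L1_def p int_coset_def prod.case mem_Collect_eq by blast
  next
    fix p :: "real \<times> real" assume "p \<in> L1"
    then obtain i j :: int where p: "p = (2 * of_int i + 4/3, of_int j + 1/3)" by (auto simp: L1_def int_coset_def)
    have "- (2 * real_of_int i + 4/3) / 2 = of_int (- i - 1) + 1/3" "real_of_int j + 1/3 + (2 * of_int i + 4/3) / 2 = of_int (i + j + 1) + 0"
      by (simp_all add: field_simps)
    then show "(case p of (x, y) \<Rightarrow> (- x / 2, y + x / 2)) \<in> int_coset (1/3) \<times> int_coset 0"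
      unfolding p int_coset_def prod.case mem_Sigma_iff mem_Collect_eq by blast
  qed (auto simp: G_def f_def g_def)
  finally have 1: "(G has_sum - (theta 3 2 1 w1 * theta 1 0 0 w2)) L1" by (simp add: has_sum_uminus)
  have "L0 \<inter> L1 = {}"
  proof -
    have "2 * real_of_int i + 1/3 \<noteq> 2 * of_int j + 4/3" for i j
    proof
      assume "2 * real_of_int i + 1/3 = 2 * of_int j + 4/3"
      then have "real_of_int (2 * i) = of_int (2 * j + 1)" by simp
      then have "2 * i = 2 * j + 1" by (simp only: of_int_eq_iff)
      then show False by presburger
    qed
    then show ?thesis by (auto simp: L0_def L1_def)
  qed
  with 0 1 have "(G has_sum h w1 w2) (L0 \<union> L1)"
    using has_sum_Un_disjoint[OF 0 1] by (simp add: h_def)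
  also have "L0 \<union> L1 = hex_lattice"
  proof (intro equalityI subsetI)
    fix p assume "p \<in> hex_lattice"
    then obtain i :: int and y where p: "p = (of_int i + 1/3, y)" "y \<in> int_coset (1/3)" by (auto simp: int_coset_def)
    show "p \<in> L0 \<union> L1"
    proof (cases "even i")
      case True
      then obtain j where "i = 2 * j" by auto
      then have "real_of_int i + 1/3 = 2 * of_int j + 1/3" by simp
      then show ?thesis using p unfolding L0_def by blast
    next
      case False
      then obtain j where "i = 2 * j + 1" by (auto elim: oddE)
      then have "real_of_int i + 1/3 = 2 * of_int j + 4/3" by simp
      then show ?thesis using p unfolding L1_def by blast
    qed
  next
    have "2 * real_of_int j + 1/3 = of_int (2 * j) + 1/3" "2 * real_of_int j + 4/3 = of_int (2 * j + 1) + 1/3" for j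
      by simp_all
    then have "2 * real_of_int j + 1/3 \<in> int_coset (1/3)" "2 * real_of_int j + 4/3 \<in> int_coset (1/3)" for j
      unfolding int_coset_def by blast+
    then show "p \<in> hex_lattice" if "p \<in> L0 \<union> L1" for p
      using that by (auto simp: L0_def L1_def)
  qed
  finally show ?thesis unfolding G_def .
qed

lemma hex_form_split: "3 * (x / 2)\<^sup>2 + (y + x / 2)\<^sup>2 = x\<^sup>2 + x * y + y\<^sup>2" for x y :: real
  by (simp add: power2_eq_square field_simps)

text \<open>On the diagonal the exponents recombine to the full form and leave the weight
  \<open>x / 2\<close>, whose sum vanishes by symmetry. This removes the boundary term at
  \<open>w1\<close> from the regularized integral.\<close>

lemma h_diagonal:
  assumes "Im w > 0"
  shows "h w w = 0"
proof -
  have "h w w = hexsum w (\<lambda>x y. 1 / 2 * x)"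
    using infsumI[OF has_sum_h[OF assms assms]]
    by (simp add: hexsum_def hex_form_split flip: qpow_add)
  also have "\<dots> = 0"
    unfolding hexsum_cmult hexsum_fst[OF assms] by simp
  finally show ?thesis .
qed

section \<open>Enumeration of the lattice by natural numbers\<close>

lemma has_sum_imp_sums_enum:
  assumes "(f has_sum S) A" "bij_betw e (UNIV :: nat set) A"
  shows "(\<lambda>n. f (e n)) sums S"
  using has_sum_imp_sums has_sum_reindex_bij_betw[OF assms(2)] assms(1) by blast

lemma summable_on_imp_summable_enum:
  fixes f :: "_ \<Rightarrow> real"
  assumes "f summable_on A" "bij_betw e (UNIV :: nat set) A"
  shows "summable (\<lambda>n. f (e n))"
  using has_sum_imp_sums_enum[OF _ assms(2)] assms(1) has_sum_infsum sums_summable by blast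

lemma countable_infinite_hex_lattice: "countable hex_lattice" "infinite hex_lattice"
proof -
  have eq: "int_coset (1/3) = range (\<lambda>j. of_int j + 1/3)" by (auto simp: int_coset_def)
  show "countable hex_lattice" unfolding eq by (intro countable_SIGMA) auto
  have "infinite (int_coset (1/3))"
    unfolding eq by (auto dest!: finite_imageD simp: inj_def)
  then show "infinite hex_lattice" by (auto simp: finite_cartesian_product_iff eq)
qed

text \<open>\<open>infsum\<close>, \<open>Lim\<close> and \<open>integral\<close> are total and
  return some value even without convergence, so convergence is asserted alongside the
  identity.\<close>

theorem proposition5p4:
  fixes \<tau> :: complex
  assumes "Im \<tau> > 0"
  shows "Psi_term \<tau> summable_on int_coset (1/3) \<times> int_coset (1/3) \<and>
         (\<forall>s>0. reg_integrable \<tau> (\<tau> + \<i> * complex_of_real s) (h (\<tau> + \<i> * complex_of_real s))) \<and>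
         vertical_integrable \<tau> (\<lambda>w1. reg_integral \<tau> w1 (h w1) / csqrt (\<i> * (w1 - \<tau>))) \<and>
         Psi \<tau> = complex_of_real (sqrt 3 / (2 * pi)) *
           vertical_integral \<tau> (\<lambda>w1. reg_integral \<tau> w1 (h w1) / csqrt (\<i> * (w1 - \<tau>)))"
proof -
  define Q where "Q = (\<lambda>x y :: real. x\<^sup>2 + x * y + y\<^sup>2)"
  obtain e :: "nat \<Rightarrow> real \<times> real" where e: "bij_betw e UNIV hex_lattice"
    using countableE_infinite[OF countable_infinite_hex_lattice] bij_betw_inv_into by metis
  define X Y where "X = (\<lambda>n. fst (e n))" and "Y = (\<lambda>n. snd (e n))"
  have XY: "e n = (X n, Y n)" for n by (simp add: X_def Y_def)
  have X0: "X n \<noteq> 0" for n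
    using bij_betwE[OF e] int_coset_third_nonzero[of "X n"] by (auto simp: XY)
  \<comment> \<open>Raising \<open>w1\<close> by \<open>s\<close> and \<open>w2\<close> by
    \<open>u\<close> multiplies a term of \<open>h\<close> by \<open>exp (- a n * s)\<close> and
    \<open>exp (- b n * u)\<close>, by \<open>qpow_vertical\<close>; \<open>k n\<close> is the term
    at \<open>s = u = 0\<close>.\<close>
  define k where "k = (\<lambda>n. of_real (X n / 2) * qpow \<tau> (Q (X n) (Y n)))"
  define a where "a = (\<lambda>n. 2 * pi * (3 * (X n / 2)\<^sup>2))"
  define b where "b = (\<lambda>n. 2 * pi * (Y n + X n / 2)\<^sup>2)"
  define t where "t = (\<lambda>n. (2 * Y n + X n) / (sqrt 3 * X n))"
  have a: "a n > 0" for n using X0[of n] by (simp add: a_def)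
  have b: "b n \<ge> 0" for n by (simp add: b_def)

  have sums_hex: "(\<lambda>n. of_real (g (X n) (Y n)) * qpow \<tau> (Q (X n) (Y n))) sums hexsum \<tau> g" if "hex_bounded g" for g
  proof -
    from has_sum_imp_sums_enum[OF has_sum_infsum[OF hex_bounded_summable'[OF assms that]] e] show ?thesis
      by (simp add: XY hexsum_def Q_def)
  qed
  have summable_hex: "summable (\<lambda>n. norm (of_real (g (X n) (Y n)) * qpow \<tau> (Q (X n) (Y n))))"
    if "\<And>x y. \<bar>g x y\<bar> \<le> C * ((1 + \<bar>x\<bar>) ^ p * (1 + \<bar>y\<bar>) ^ p)" for g C p
    using summable_on_imp_summable_enum[OF hex_gaussian_summable_on[OF assms that] e]
    by (simp add: XY Q_def)

  have kb: "summable (\<lambda>n. norm (k n) * b n)"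
  proof -
    \<comment> \<open>The exponent 3 counts the factors \<open>\<bar>x\<bar>\<close> and twice
      \<open>\<bar>y + x / 2\<bar>\<close>, each at most
      \<open>(1 + \<bar>x\<bar>) * (1 + \<bar>y\<bar>)\<close>.\<close>
    have "\<bar>x / 2 * (2 * pi * (y + x / 2)\<^sup>2)\<bar> \<le> pi * ((1 + \<bar>x\<bar>) ^ 3 * (1 + \<bar>y\<bar>) ^ 3)" for x y :: real
    proof -
      have "\<bar>y + x / 2\<bar> \<le> (1 + \<bar>x\<bar>) * (1 + \<bar>y\<bar>)"
      proof -
        have "\<bar>y + x / 2\<bar> \<le> 1 + \<bar>x\<bar> + \<bar>y\<bar>" by (auto simp: abs_if)
        also have "\<dots> \<le> (1 + \<bar>x\<bar>) * (1 + \<bar>y\<bar>)" by (simp add: algebra_simps)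
        finally show ?thesis .
      qed
      then have "\<bar>y + x / 2\<bar>\<^sup>2 \<le> ((1 + \<bar>x\<bar>) * (1 + \<bar>y\<bar>))\<^sup>2" by (rule power_mono) simp
      moreover have "\<bar>x\<bar> \<le> (1 + \<bar>x\<bar>) * (1 + \<bar>y\<bar>)" by (simp add: algebra_simps)
      ultimately have "\<bar>x\<bar> * \<bar>y + x / 2\<bar>\<^sup>2 \<le> ((1 + \<bar>x\<bar>) * (1 + \<bar>y\<bar>)) * ((1 + \<bar>x\<bar>) * (1 + \<bar>y\<bar>))\<^sup>2"
        by (intro mult_mono) auto
      then have "pi * (\<bar>x\<bar> * \<bar>y + x / 2\<bar>\<^sup>2) \<le> pi * ((1 + \<bar>x\<bar>) ^ 3 * (1 + \<bar>y\<bar>) ^ 3)"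
        by (intro mult_left_mono) (auto simp: power2_eq_square power3_eq_cube mult_ac)
      then show ?thesis by (simp add: abs_mult mult_ac)
    qed
    from summable_hex[OF this] show ?thesis
      unfolding k_def b_def norm_mult norm_of_real abs_mult by (simp add: mult_ac)
  qed
  have k: "summable (\<lambda>n. norm (k n))"
  proof -
    have "\<bar>x / 2\<bar> \<le> 1 * ((1 + \<bar>x\<bar>) ^ 1 * (1 + \<bar>y\<bar>) ^ 1)" for x y :: real
      by (simp add: algebra_simps)
    from summable_hex[OF this] show ?thesis unfolding k_def .
  qed

  have sqrt_ba: "sqrt (b n / a n) = \<bar>t n\<bar>" for n
  proof -
    have "b n / a n = (t n)\<^sup>2"
      using X0[of n] by (simp add: a_def b_def t_def power_divide power_mult_distrib) (simp add: power2_eq_square field_simps)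
    then show ?thesis by simp
  qed
  have kt: "k n * (sqrt (b n / a n) * arctan (sqrt (b n / a n))) =
      of_real (1 / sqrt 3 * ((2 * Y n + X n) / 2 * arctan ((2 * Y n + X n) / (sqrt 3 * X n)))) * qpow \<tau> (Q (X n) (Y n))" for n
  proof -
    \<comment> \<open>The function \<open>t * arctan t\<close> is even, so the absolute value coming
      from the root disappears.\<close>
    have 1: "sqrt (b n / a n) * arctan (sqrt (b n / a n)) = t n * arctan (t n)"
      unfolding sqrt_ba by (simp add: abs_if arctan_minus)
    have 2: "X n / 2 * (t n * arctan (t n)) = 1 / sqrt 3 * ((2 * Y n + X n) / 2 * arctan (t n))"
      using X0[of n] by (simp add: t_def)
    have "k n * of_real (t n * arctan (t n)) = of_real (X n / 2 * (t n * arctan (t n))) * qpow \<tau> (Q (X n) (Y n))"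
      by (simp add: k_def)
    then show ?thesis
      unfolding 1 2 by (simp only: t_def)
  qed
  note bA = hex_bounded_cmult[OF hex_bounded_arctan, of "1 / sqrt 3"]
  have kt_sums: "(\<Sum>n. k n * (sqrt (b n / a n) * arctan (sqrt (b n / a n)))) = 1 / sqrt 3 * (pi / 2 * Psi \<tau>)"
    using sums_unique[OF sums_hex[OF bA]] unfolding kt hexsum_cmult hexsum_arctan[OF assms] by simp
  have kt_summable: "summable (\<lambda>n. norm (k n) * (sqrt (b n / a n) * arctan (sqrt (b n / a n))))"
  proof -
    have "summable (\<lambda>n. norm (k n * (sqrt (b n / a n) * arctan (sqrt (b n / a n)))))"
      unfolding kt using summable_on_imp_summable_enum[OF hex_bounded_summable[OF assms bA] e]
      by (simp add: XY Q_def)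
    then show ?thesis using a b by (simp add: norm_mult abs_mult less_imp_le)
  qed

  have h_series: "h (\<tau> + \<i> * of_real s) (\<tau> + \<i> * of_real u) = (\<Sum>n. (k n * exp (- a n * s)) * exp (- b n * u))"
    if "s > 0" "u \<ge> 0" for s u
  proof -
    have "(\<lambda>n. of_real (X n / 2) * (qpow (\<tau> + \<i> * of_real s) (3 * (X n / 2)\<^sup>2) * qpow (\<tau> + \<i> * of_real u) ((Y n + X n / 2)\<^sup>2)))
        sums h (\<tau> + \<i> * of_real s) (\<tau> + \<i> * of_real u)"
      using has_sum_imp_sums_enum[OF has_sum_h e] assms that by (simp add: XY)
    also have "(\<lambda>n. of_real (X n / 2) * (qpow (\<tau> + \<i> * of_real s) (3 * (X n / 2)\<^sup>2) * qpow (\<tau> + \<i> * of_real u) ((Y n + X n / 2)\<^sup>2)))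
       = (\<lambda>n. (k n * exp (- a n * s)) * exp (- b n * u))"
      unfolding qpow_vertical k_def Q_def a_def b_def hex_form_split[symmetric] qpow_add by (simp only: mult_ac)
    finally show ?thesis by (simp only: sums_iff)
  qed

  \<comment> \<open>Minus the \<open>u\<close>-derivative of the series for \<open>h\<close>; the
    sign turns the \<open>- 4\<close> of \<open>reg_approx_vertical_tendsto\<close> into
    \<open>4\<close>.\<close>
  define G where "G = (\<lambda>s u. \<Sum>n. (k n * exp (- a n * s)) * b n * exp (- b n * u))"
  have reg: "(reg_approx \<tau> (\<tau> + \<i> * of_real s) (h (\<tau> + \<i> * of_real s)) \<longlongrightarrow>
      4 * integral {0..sqrt s} (\<lambda>x. G s (x\<^sup>2))) (at_right 0)" if s: "s > 0" for s
  proof -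
    have le: "norm (k n * complex_of_real (exp (- a n * s))) \<le> norm (k n)" for n
      using a[of n] s by (simp add: norm_mult mult_left_le)
    have c: "summable (\<lambda>n. norm (k n * complex_of_real (exp (- a n * s))))"
      by (rule summable_comparison_test[OF _ k]) (use le in auto)
    have cb: "summable (\<lambda>n. norm (k n * complex_of_real (exp (- a n * s))) * b n)"
      by (rule summable_comparison_test[OF _ kb]) (use mult_right_mono[OF le b] b in \<open>auto simp: abs_mult\<close>)
    have D: "((\<lambda>u. h (\<tau> + \<i> * of_real s) (\<tau> + \<i> * of_real u)) has_vector_derivative - G s u) (at u within {0..s})"
      if u: "u \<in> {0..s}" for u
    proof (rule has_vector_derivative_transform[OF u h_series[OF s]])
      show "((\<lambda>u. \<Sum>n. (k n * exp (- a n * s)) * exp (- b n * u)) has_vector_derivative - G s u) (at u within {0..s})"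
        unfolding G_def using exp_series_has_vector_derivative(1)[OF b c cb, of u] u
        by (auto intro: has_vector_derivative_within_subset)
    qed auto
    have cont: "continuous_on {0..s} (\<lambda>u. - G s u)"
      unfolding G_def using exp_series_has_vector_derivative(2)[OF b c cb]
      by (intro continuous_on_minus) (auto intro: continuous_on_subset)
    have "h (\<tau> + \<i> * of_real s) (\<tau> + \<i> * of_real s) = 0"
      using assms s by (intro h_diagonal) simp
    then show ?thesis
      using reg_approx_vertical_tendsto[OF s D cont] by simp
  qed
  have integrand: "reg_integral \<tau> (\<tau> + \<i> * of_real s) (h (\<tau> + \<i> * of_real s))
        / csqrt (\<i> * (\<tau> + \<i> * of_real s - \<tau>)) * \<i>
      = 4 * integral {0..1} (\<lambda>x. \<Sum>n. k n * b n * exp (- s * (a n + b n * x\<^sup>2)))" if s: "s > 0" for s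
  proof -
    have R: "reg_integral \<tau> (\<tau> + \<i> * of_real s) (h (\<tau> + \<i> * of_real s)) = 4 * integral {0..sqrt s} (\<lambda>x. G s (x\<^sup>2))"
      unfolding reg_integral_def by (rule tendsto_Lim[OF _ reg[OF s]]) simp
    \<comment> \<open>Rescaling to \<open>{0..1}\<close> absorbs the factor
      \<open>1 / sqrt s\<close>, which is what \<open>csqrt (- s) = \<i> * sqrt s\<close> and the
      \<open>\<i>\<close> of \<open>dw1\<close> leave.\<close>
    have "(\<lambda>x. x / sqrt s) ` {0..sqrt s} = {0..1}"
      using s by (simp add: image_divide_atLeastAtMost)
    then have "integral {0..1} (\<lambda>x. G s ((sqrt s * x)\<^sup>2)) = integral {0..sqrt s} (\<lambda>x. G s (x\<^sup>2)) / sqrt s"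
      using s integral_stretch_real[of "sqrt s" 0 "sqrt s" "\<lambda>x. G s (x\<^sup>2)"]
      by (simp add: scaleR_conv_of_real)
    moreover have "G s ((sqrt s * x)\<^sup>2) = (\<Sum>n. k n * b n * exp (- s * (a n + b n * x\<^sup>2)))" for x
    proof -
      have "exp (- s * (a n + b n * x\<^sup>2)) = exp (- a n * s) * exp (- b n * (sqrt s * x)\<^sup>2)" for n
        using s by (simp add: power_mult_distrib algebra_simps flip: exp_add)
      then show ?thesis unfolding G_def by (simp add: mult_ac)
    qed
    ultimately have "integral {0..1} (\<lambda>x. \<Sum>n. k n * b n * exp (- s * (a n + b n * x\<^sup>2))) =
       integral {0..sqrt s} (\<lambda>x. G s (x\<^sup>2)) / sqrt s" by simp
    then show ?thesis
      unfolding R using s by (simp add: csqrt_neg_real field_simps)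
  qed
  \<comment> \<open>The value equals \<open>2 * pi / sqrt 3\<close> times \<open>Psi \<tau>\<close>,
    which explains the prefactor \<open>sqrt 3 / (2 * pi)\<close>.\<close>
  have V: "((\<lambda>s. reg_integral \<tau> (\<tau> + \<i> * of_real s) (h (\<tau> + \<i> * of_real s))
        / csqrt (\<i> * (\<tau> + \<i> * of_real s - \<tau>)) * \<i>) has_integral 4 * (1 / sqrt 3 * (pi / 2 * Psi \<tau>))) {0<..}"
    using has_integral_mult_right[OF integral_laplace_series[OF a b kb kt_summable], of 4]
    unfolding kt_sums by (rule has_integral_eq[rotated]) (rule integrand[symmetric], simp)
  have "Psi_term \<tau> summable_on hex_lattice"
  proof -
    have "hex_bounded (\<lambda>x y. sgn x * sgn y * x)"
      by (rule hex_boundedI[where C = 1]) (auto simp: abs_mult sgn_if)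
    from hex_bounded_summable'[OF assms this] show ?thesis
      unfolding Psi_term_def .
  qed
  moreover have "\<forall>s>0. reg_integrable \<tau> (\<tau> + \<i> * of_real s) (h (\<tau> + \<i> * of_real s))"
    using reg unfolding reg_integrable_def by blast
  moreover have "vertical_integrable \<tau> (\<lambda>w1. reg_integral \<tau> w1 (h w1) / csqrt (\<i> * (w1 - \<tau>)))"
    using V unfolding vertical_integrable_def integrable_on_def by blast
  moreover have "complex_of_real (sqrt 3 / (2 * pi)) *
           vertical_integral \<tau> (\<lambda>w1. reg_integral \<tau> w1 (h w1) / csqrt (\<i> * (w1 - \<tau>))) = Psi \<tau>"
    unfolding vertical_integral_def integral_unique[OF V] by (simp add: field_simps)
  ultimately show ?thesis by simp
qed

end
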